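(* Let $d\ge2$ and let $X=(X_1,\dots,X_d)\in\mathbb R^d$ be a zero-mean Gaussian random vector. Let $\bar\sigma^2=\max_{j\in[d]}\mathbb E[X_j^2]>0$ (with $\bar\sigma>0$). Then for any $t\ge\bar\sigma\,\Phi^{-1}(0.95)$ and any $\epsilon>0$ with $\epsilon<\frac18 t$, $$\mathbb P\Bigl(\bigl|\max_{j\in[d]}X_j-t\bigr|\le\epsilon\Bigr)\le 2\epsilon\,\frac{\sqrt{\log d}}{\bar\sigma}\,\bigl\{\sqrt{2\log(2d)}+3\bigr\}.$$
   Context: $[d]=\{1,\dots,d\}$ and $\Phi$ is the standard normal cumulative distribution function on $\mathbb R$. The covariance matrix of $X$ is arbitrary (possibly singular, with possibly zero variances for some coordinates). *)

theory Defs
  imports "HOL-Probability.Probability"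
begin

definition std_normal_cdf :: "real \<Rightarrow> real" where
  "std_normal_cdf = cdf std_normal_distribution"

(* std_normal_cdf is strictly increasing with range {0<..<1}, so on that interval
   inv yields the genuine inverse; outside it the value is unspecified. *)
definition std_normal_quantile :: "real \<Rightarrow> real" where
  "std_normal_quantile = inv std_normal_cdf"

(* The second disjunct is the normal law with variance 0, which has no Lebesgue density. *)
definition gaussian_rv :: "'a measure \<Rightarrow> ('a \<Rightarrow> real) \<Rightarrow> bool" where
  "gaussian_rv M Y \<longleftrightarrow> Y \<in> borel_measurable M \<and>
     (\<exists>\<mu> \<sigma>. (\<sigma> > 0 \<and> distributed M lborel Y (normal_density \<mu> \<sigma>)) \<or> (AE \<omega> in M. Y \<omega> = \<mu>))"

(* Joint Gaussianity: every linear combination of the coordinates is Gaussian. Degenerate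
   combinations are admitted, so the covariance matrix may be singular. *)
definition gaussian_vector :: "'a measure \<Rightarrow> 'i set \<Rightarrow> ('i \<Rightarrow> 'a \<Rightarrow> real) \<Rightarrow> bool" where
  "gaussian_vector M I X \<longleftrightarrow>
     (\<forall>j\<in>I. X j \<in> borel_measurable M) \<and>
     (\<forall>a. gaussian_rv M (\<lambda>\<omega>. \<Sum>j\<in>I. a j * X j \<omega>))"

definition zero_mean_gaussian_vector :: "'a measure \<Rightarrow> 'i set \<Rightarrow> ('i \<Rightarrow> 'a \<Rightarrow> real) \<Rightarrow> bool" where
  "zero_mean_gaussian_vector M I X \<longleftrightarrow>
     gaussian_vector M I X \<and> (\<forall>j\<in>I. integral\<^sup>L M (X j) = 0)"

end

theory Submission imports Defs begin

text \<open>
  The proof bounds the density of the maximum \<open>Y\<close> of the \<open>X j\<close> at a level \<open>x > 0\<close>. Write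
  \<open>X k = reg j k * X j + residual j k\<close>, where the residuals are independent of \<open>X j\<close>. On the event
  that \<open>j\<close> is the (least) index of the maximum and \<open>X j = x\<close>, the residuals satisfy certain
  inequalities depending on \<open>x\<close>; let \<open>G j x\<close> be the probability of those inequalities
  (\<open>prob (facet j x)\<close> below). The density of \<open>Y\<close> at \<open>x\<close> is then the sum of \<open>n j x * G j x\<close>, where
  \<open>n j\<close> is the density of \<open>X j\<close> and \<open>j\<close> runs through the indices of positive variance.

  The central observation, due to Nazarov in his work on Gaussian surface areas of polytopes, is that
  the events ``\<open>X j > x\<close> and the residuals satisfy the inequalities at \<open>x\<close>'' are pairwise
  disjoint. They are the outward shadows of distinct facets of a convex set; algebraically,
  the disjointness is the Cauchy--Schwarz inequality (\<open>sum_shadow_le_1\<close>). By independence the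
  probability of such an event is \<open>prob (X j > x) * G j x\<close>, so these products have sum at most \<open>1\<close>.
  Mills' ratio compares \<open>n j x\<close> with \<open>prob (X j > x)\<close>: with \<open>r = x / sqrt (var j)\<close>,
  \<open>x * n j x \<le> (r\<^sup>2 + 1) * prob (X j > x)\<close>. This is used if \<open>r\<^sup>2 \<le> 2 * ln d\<close>; for the other indices
  \<open>x * n j x\<close> itself is at most \<open>sqrt (ln d / pi) / d\<close>. Altogether the density of \<open>Y\<close> at \<open>x\<close> is at most
  \<open>(2 * ln d + 1 + sqrt (ln d / pi)) / x\<close>, whatever the covariance. Integration
  gives \<open>prob_max_in_interval_le\<close>.

  It remains to compare constants: \<open>ln ((t + \<epsilon>) / (t - \<epsilon>))\<close> is at most \<open>64 / 63 * (2 * \<epsilon> / t)\<close> because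
  \<open>\<epsilon> < t / 8\<close>, and \<open>t \<ge> 1.437 * \<sigma>\<close> because the quantile at level \<open>0.95\<close> exceeds \<open>1.437\<close>. Since
  \<open>2 * 64 / 63 / 1.437 < sqrt 2\<close>, the coefficient of the leading term \<open>ln d\<close> fits.

  The independence of the residuals rests on a multivariate uniqueness theorem: finite measures with
  the same trigonometric integrals give the same mass to all rectangles. It is derived from Levy's
  one-dimensional theorem by weighting with \<open>1 + cos\<close> of the remaining coordinates.
\<close>

section \<open>Finite measures and trigonometric integrals\<close>

lemma (in finite_measure) integrable_cis:
  assumes [measurable]: "Z \<in> borel_measurable M"
  shows "integrable M (\<lambda>\<omega>. cis (Z \<omega>))"
  by (rule integrable_const_bound[where B = 1]) (auto simp: cis_conv_exp)

lemma (in finite_measure) integral_cos_shift: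
  assumes [measurable]: "Z \<in> borel_measurable M"
  shows "(\<integral>\<omega>. cos (Z \<omega> + \<theta>) \<partial>M) = Re (cis \<theta> * (\<integral>\<omega>. cis (Z \<omega>) \<partial>M))"
proof -
  have "(\<integral>\<omega>. cos (Z \<omega> + \<theta>) \<partial>M) = (\<integral>\<omega>. Re (cis \<theta> * cis (Z \<omega>)) \<partial>M)"
    by (simp add: cis_mult add.commute)
  also have "\<dots> = Re (\<integral>\<omega>. cis \<theta> * cis (Z \<omega>) \<partial>M)"
    by (rule integral_Re) (intro integrable_mult_right integrable_cis assms)
  also have "\<dots> = Re (cis \<theta> * (\<integral>\<omega>. cis (Z \<omega>) \<partial>M))"
    by simp
  finally show ?thesis .
qed

lemma (in finite_measure) integral_cis_eq_cos:
  assumes [measurable]: "Z \<in> borel_measurable M"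
  shows "(\<integral>\<omega>. cis (Z \<omega>) \<partial>M) = Complex (\<integral>\<omega>. cos (Z \<omega> + 0) \<partial>M) (\<integral>\<omega>. cos (Z \<omega> + - (pi/2)) \<partial>M)"
  unfolding integral_cos_shift[OF assms] by (simp add: complex_eq_iff)

text \<open>Levy's uniqueness theorem concerns probability measures, so both measures are divided by their
common total mass, which is the hypothesis at \<open>s = 0\<close>.\<close>
lemma finite_measure_eq_if_integral_cis_eq:
  fixes X :: "'a \<Rightarrow> real"
  assumes N1: "finite_measure N1" and N2: "finite_measure N2"
    and sets: "sets N1 = sets N2"
    and X1: "X \<in> borel_measurable N1"
    and eq: "\<And>s. (\<integral>\<omega>. cis (s * X \<omega>) \<partial>N1) = (\<integral>\<omega>. cis (s * X \<omega>) \<partial>N2)"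
    and B: "B \<in> sets borel"
  shows "measure N1 (X -` B \<inter> space N1) = measure N2 (X -` B \<inter> space N2)"
proof -
  interpret N1: finite_measure N1 by fact
  interpret N2: finite_measure N2 by fact
  have X2: "X \<in> borel_measurable N2" using X1 sets measurable_cong_sets by blast
  define c where "c = measure N1 (space N1)"
  have c2: "measure N2 (space N2) = c"
    using eq[of 0] by (simp add: c_def cis_conv_exp)
  show ?thesis
  proof (cases "c = 0")
    case True
    have "measure N1 A = 0" "measure N2 A = 0" for A
      using N1.bounded_measure[of A] N2.bounded_measure[of A] True c2
      by (auto simp: c_def measure_le_0_iff)
    then show ?thesis by simp
  next
    case False
    then have c: "c > 0" by (simp add: c_def zero_less_measure_iff)
    have main: "real_distribution (distr (density N (\<lambda>_. ennreal (1/c))) borel X) \<and>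
        char (distr (density N (\<lambda>_. ennreal (1/c))) borel X) s = (1/c) *\<^sub>R (\<integral>\<omega>. cis (s * X \<omega>) \<partial>N) \<and>
        measure (distr (density N (\<lambda>_. ennreal (1/c))) borel X) B = (1/c) * measure N (X -` B \<inter> space N)"
      if fin: "finite_measure N" and m: "measure N (space N) = c" and X[measurable]: "X \<in> borel_measurable N"
      for N s
    proof -
      interpret N: finite_measure N by fact
      have "emeasure (density N (\<lambda>_. ennreal (1/c))) (space N) = ennreal (1/c) * emeasure N (space N)"
        by (subst emeasure_density) (auto simp: nn_integral_cmult_indicator)
      also have "\<dots> = 1"
        using c by (simp add: N.emeasure_eq_measure m ennreal_mult'[symmetric])
      finally interpret D: prob_space "density N (\<lambda>_. ennreal (1/c))"
        by (intro prob_spaceI) simp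
      have 1: "real_distribution (distr (density N (\<lambda>_. ennreal (1/c))) borel X)"
        by (rule D.real_distribution_distr) simp
      have "char (distr (density N (\<lambda>_. ennreal (1/c))) borel X) s
          = (\<integral>\<omega>. iexp (s * X \<omega>) \<partial>density N (\<lambda>_. ennreal (1/c)))"
        unfolding char_def by (subst integral_distr) auto
      also have "\<dots> = (\<integral>\<omega>. (1/c) *\<^sub>R cis (s * X \<omega>) \<partial>N)"
        using c by (subst integral_density) (auto simp: cis_conv_exp)
      finally have 2: "char (distr (density N (\<lambda>_. ennreal (1/c))) borel X) s = (1/c) *\<^sub>R (\<integral>\<omega>. cis (s * X \<omega>) \<partial>N)"
        by simp
      have 3: "measure (distr (density N (\<lambda>_. ennreal (1/c))) borel X) B = (1/c) * measure N (X -` B \<inter> space N)"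
        using B c by (subst measure_distr)
          (auto simp: measure_def emeasure_density nn_integral_cmult_indicator enn2real_mult)
      show ?thesis using 1 2 3 by simp
    qed
    have "distr (density N1 (\<lambda>_. ennreal (1/c))) borel X = distr (density N2 (\<lambda>_. ennreal (1/c))) borel X"
      using main[OF N1 c_def[symmetric] X1] main[OF N2 c2 X2] eq
      by (intro Levy_uniqueness) (auto simp: fun_eq_iff)
    then show ?thesis
      using main[OF N1 c_def[symmetric] X1] main[OF N2 c2 X2] c by simp
  qed
qed

text \<open>The one-dimensional theorem is applied to measures with density \<open>1 + cos (T + \<eta>)\<close>, which is
nonnegative. The product formula for cosines writes the trigonometric integrals of \<open>X\<close> under such a
measure through integrals of \<open>cis (s * X + b * T)\<close> with \<open>b\<close> in \<open>{- 1, 0, 1}\<close>. So the laws of \<open>X\<close> under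
the two weighted measures agree, and subtracting the unweighted identity leaves \<open>cos (T + \<eta>)\<close>
integrated over the event that \<open>X\<close> lies in \<open>B\<close>. The phases \<open>0\<close> and \<open>- pi / 2\<close> give the real and
imaginary parts.\<close>
lemma integral_cis_indicator_eq:
  fixes X T :: "'a \<Rightarrow> real"
  assumes N1: "finite_measure N1" and N2: "finite_measure N2"
    and sets: "sets N1 = sets N2"
    and X1: "X \<in> borel_measurable N1" and T1: "T \<in> borel_measurable N1"
    and eq: "\<And>s b. (\<integral>\<omega>. cis (s * X \<omega> + b * T \<omega>) \<partial>N1) = (\<integral>\<omega>. cis (s * X \<omega> + b * T \<omega>) \<partial>N2)"
    and B: "B \<in> sets borel"
  shows "(\<integral>\<omega>. cis (T \<omega>) \<partial>density N1 (indicator (X -` B \<inter> space N1)))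
       = (\<integral>\<omega>. cis (T \<omega>) \<partial>density N2 (indicator (X -` B \<inter> space N2)))"
proof -
  interpret N1: finite_measure N1 by fact
  interpret N2: finite_measure N2 by fact
  have X2: "X \<in> borel_measurable N2" and T2: "T \<in> borel_measurable N2"
    using X1 T1 sets measurable_cong_sets by blast+
  define w where "w \<eta> \<omega> = 1 + cos (T \<omega> + \<eta>)" for \<eta> \<omega>
  have w0: "w \<eta> \<omega> \<ge> 0" for \<eta> \<omega> using cos_ge_minus_one[of "T \<omega> + \<eta>"] unfolding w_def by linarith
  have prep: "finite_measure (density N (\<lambda>\<omega>. ennreal (w \<eta> \<omega>)))
      \<and> (\<integral>\<omega>. cos (s * X \<omega> + \<theta>) \<partial>density N (\<lambda>\<omega>. ennreal (w \<eta> \<omega>)))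
        = (\<integral>\<omega>. cos (s * X \<omega> + 0 * T \<omega> + \<theta>) \<partial>N) + (\<integral>\<omega>. cos (s * X \<omega> + 1 * T \<omega> + (\<theta> + \<eta>)) \<partial>N) / 2
          + (\<integral>\<omega>. cos (s * X \<omega> + (-1) * T \<omega> + (\<theta> - \<eta>)) \<partial>N) / 2
      \<and> measure (density N (\<lambda>\<omega>. ennreal (w \<eta> \<omega>))) (X -` B \<inter> space N)
        = measure N (X -` B \<inter> space N)
          + (\<integral>\<omega>. cos (T \<omega> + \<eta>) \<partial>density N (indicator (X -` B \<inter> space N)))"
    if "finite_measure N" and X[measurable]: "X \<in> borel_measurable N" and T[measurable]: "T \<in> borel_measurable N"
    for N s \<theta> \<eta>
  proof -
    interpret N: finite_measure N by fact
    have int: "integrable N (\<lambda>\<omega>. cos (Z \<omega>))" if [measurable]: "Z \<in> borel_measurable N" for Z :: "'a \<Rightarrow> real"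
      by (rule N.integrable_const_bound[where B = 1]) auto
    have wint: "integrable N (w \<eta>)" unfolding w_def by (intro Bochner_Integration.integrable_add int) auto
    have wmeas[measurable]: "w \<eta> \<in> borel_measurable N" using wint by auto
    have "emeasure (density N (\<lambda>\<omega>. ennreal (w \<eta> \<omega>))) (space N) = ennreal (\<integral>\<omega>. w \<eta> \<omega> \<partial>N)"
      by (subst emeasure_density)
        (auto simp: nn_integral_eq_integral[OF wint] w0 cong: nn_integral_cong_simp)
    then have 1: "finite_measure (density N (\<lambda>\<omega>. ennreal (w \<eta> \<omega>)))"
      by (intro finite_measureI) simp
    have "(\<integral>\<omega>. cos (s * X \<omega> + \<theta>) \<partial>density N (\<lambda>\<omega>. ennreal (w \<eta> \<omega>)))
        = (\<integral>\<omega>. w \<eta> \<omega> * cos (s * X \<omega> + \<theta>) \<partial>N)"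
      by (subst integral_density) (auto simp: w0)
    also have "\<dots> = (\<integral>\<omega>. cos (s * X \<omega> + 0 * T \<omega> + \<theta>) + cos (s * X \<omega> + 1 * T \<omega> + (\<theta> + \<eta>)) / 2
        + cos (s * X \<omega> + (-1) * T \<omega> + (\<theta> - \<eta>)) / 2 \<partial>N)"
    proof (rule Bochner_Integration.integral_cong[OF refl])
      fix \<omega>
      have "cos (s * X \<omega> + \<theta>) * cos (T \<omega> + \<eta>)
          = (cos (s * X \<omega> + \<theta> - (T \<omega> + \<eta>)) + cos (s * X \<omega> + \<theta> + (T \<omega> + \<eta>))) / 2"
        by (rule cos_times_cos)
      moreover have "s * X \<omega> + \<theta> - (T \<omega> + \<eta>) = s * X \<omega> + (-1) * T \<omega> + (\<theta> - \<eta>)"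
        "s * X \<omega> + \<theta> + (T \<omega> + \<eta>) = s * X \<omega> + 1 * T \<omega> + (\<theta> + \<eta>)" by simp_all
      ultimately show "w \<eta> \<omega> * cos (s * X \<omega> + \<theta>) = cos (s * X \<omega> + 0 * T \<omega> + \<theta>)
          + cos (s * X \<omega> + 1 * T \<omega> + (\<theta> + \<eta>)) / 2 + cos (s * X \<omega> + (-1) * T \<omega> + (\<theta> - \<eta>)) / 2"
        by (simp add: w_def algebra_simps add_divide_distrib)
    qed
    also have "\<dots> = (\<integral>\<omega>. cos (s * X \<omega> + 0 * T \<omega> + \<theta>) \<partial>N) + (\<integral>\<omega>. cos (s * X \<omega> + 1 * T \<omega> + (\<theta> + \<eta>)) \<partial>N) / 2
          + (\<integral>\<omega>. cos (s * X \<omega> + (-1) * T \<omega> + (\<theta> - \<eta>)) \<partial>N) / 2"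
      by (subst Bochner_Integration.integral_add | intro Bochner_Integration.integrable_add int integrable_divide | simp)+
    finally have 2: "(\<integral>\<omega>. cos (s * X \<omega> + \<theta>) \<partial>density N (\<lambda>\<omega>. ennreal (w \<eta> \<omega>))) = \<dots>" .
    define S where "S = X -` B \<inter> space N"
    have S[measurable]: "S \<in> sets N" using B unfolding S_def by measurable
    have "emeasure (density N (\<lambda>\<omega>. ennreal (w \<eta> \<omega>))) S = (\<integral>\<^sup>+\<omega>. ennreal (w \<eta> \<omega> * indicator S \<omega>) \<partial>N)"
      by (subst emeasure_density) (auto intro!: nn_integral_cong split: split_indicator)
    also have "\<dots> = ennreal (\<integral>\<omega>. w \<eta> \<omega> * indicator S \<omega> \<partial>N)"
      using wint by (intro nn_integral_eq_integral integrable_real_mult_indicator S) (auto simp: w0)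
    finally have "measure (density N (\<lambda>\<omega>. ennreal (w \<eta> \<omega>))) S = (\<integral>\<omega>. w \<eta> \<omega> * indicator S \<omega> \<partial>N)"
      by (simp add: measure_def w0)
    also have "\<dots> = (\<integral>\<omega>. indicator S \<omega> + indicator S \<omega> * cos (T \<omega> + \<eta>) \<partial>N)"
      by (simp add: w_def algebra_simps)
    also have "\<dots> = measure N S + (\<integral>\<omega>. indicator S \<omega> * cos (T \<omega> + \<eta>) \<partial>N)"
      using integrable_real_mult_indicator[OF S int[of "\<lambda>\<omega>. T \<omega> + \<eta>"]]
      by (subst Bochner_Integration.integral_add)
        (auto simp: mult.commute N.emeasure_eq_measure intro!: integrable_real_indicator)
    also have "(\<integral>\<omega>. indicator S \<omega> * cos (T \<omega> + \<eta>) \<partial>N) = (\<integral>\<omega>. cos (T \<omega> + \<eta>) \<partial>density N (\<lambda>\<omega>. ennreal (indicator S \<omega>)))"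
      by (subst integral_density) auto
    finally have 3: "measure (density N (\<lambda>\<omega>. ennreal (w \<eta> \<omega>))) S = measure N S
        + (\<integral>\<omega>. cos (T \<omega> + \<eta>) \<partial>density N (indicator S))"
      by (simp add: ennreal_indicator)
    show ?thesis using 1 2 3 unfolding S_def by blast
  qed
  have trig: "(\<integral>\<omega>. cos (s * X \<omega> + b * T \<omega> + \<theta>) \<partial>N1) = (\<integral>\<omega>. cos (s * X \<omega> + b * T \<omega> + \<theta>) \<partial>N2)" for s b \<theta>
    using N1.integral_cos_shift[of "\<lambda>\<omega>. s * X \<omega> + b * T \<omega>" \<theta>] N2.integral_cos_shift[of "\<lambda>\<omega>. s * X \<omega> + b * T \<omega>" \<theta>]
      X1 X2 T1 T2 eq by simp
  have cosB: "(\<integral>\<omega>. cos (T \<omega> + \<eta>) \<partial>density N1 (indicator (X -` B \<inter> space N1)))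
     = (\<integral>\<omega>. cos (T \<omega> + \<eta>) \<partial>density N2 (indicator (X -` B \<inter> space N2)))" for \<eta>
  proof -
    note p1 = prep[OF N1 X1 T1, where \<eta> = \<eta>] and p2 = prep[OF N2 X2 T2, where \<eta> = \<eta>]
    let ?D1 = "density N1 (\<lambda>\<omega>. ennreal (w \<eta> \<omega>))" and ?D2 = "density N2 (\<lambda>\<omega>. ennreal (w \<eta> \<omega>))"
    interpret D1: finite_measure ?D1 using p1 by blast
    interpret D2: finite_measure ?D2 using p2 by blast
    have "(\<integral>\<omega>. cos (s * X \<omega> + \<theta>) \<partial>?D1) = (\<integral>\<omega>. cos (s * X \<omega> + \<theta>) \<partial>?D2)" for s \<theta>
      using p1 p2 trig by metis
    then have "(\<integral>\<omega>. cis (s * X \<omega>) \<partial>?D1) = (\<integral>\<omega>. cis (s * X \<omega>) \<partial>?D2)" for s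
      using X1 X2 by (simp only: D1.integral_cis_eq_cos D2.integral_cis_eq_cos borel_measurable_times
          borel_measurable_const measurable_density_eq1)
    from finite_measure_eq_if_integral_cis_eq[OF _ _ _ _ this B]
    have "measure ?D1 (X -` B \<inter> space N1) = measure ?D2 (X -` B \<inter> space N2)"
      using D1.finite_measure_axioms D2.finite_measure_axioms sets X1 by simp
    moreover have "measure N1 (X -` B \<inter> space N1) = measure N2 (X -` B \<inter> space N2)"
      using eq[of _ 0] by (intro finite_measure_eq_if_integral_cis_eq[OF N1 N2 sets X1 _ B]) simp
    ultimately show ?thesis using p1 p2 by simp
  qed
  have fin: "finite_measure (density N (indicator (X -` B \<inter> space N)))"
    if "finite_measure N" "X \<in> borel_measurable N" for N
    using that B
    by (intro finite_measureI) (auto simp: emeasure_density finite_measure.emeasure_finite)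
  interpret E1: finite_measure "density N1 (indicator (X -` B \<inter> space N1))" by (rule fin[OF N1 X1])
  interpret E2: finite_measure "density N2 (indicator (X -` B \<inter> space N2))" by (rule fin[OF N2 X2])
  show ?thesis
    using T1 T2 by (simp only: E1.integral_cis_eq_cos E2.integral_cis_eq_cos measurable_density_eq1 cosB)
qed

text \<open>Multivariate uniqueness, one coordinate at a time: restricting both measures to the event
\<open>Y i \<in> B i\<close> preserves the equality of the trigonometric integrals in the other coordinates.\<close>
lemma finite_measure_rectangle_eq_if_integral_cis_eq:
  fixes Y :: "'i \<Rightarrow> 'a \<Rightarrow> real"
  assumes "finite I"
    and "finite_measure N1" "finite_measure N2" "sets N1 = sets N2"
    and "\<And>k. k \<in> I \<Longrightarrow> Y k \<in> borel_measurable N1"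
    and "\<And>a. (\<integral>\<omega>. cis (\<Sum>k\<in>I. a k * Y k \<omega>) \<partial>N1) = (\<integral>\<omega>. cis (\<Sum>k\<in>I. a k * Y k \<omega>) \<partial>N2)"
    and B: "\<And>k. k \<in> I \<Longrightarrow> B k \<in> sets borel"
  shows "measure N1 {\<omega> \<in> space N1. \<forall>k\<in>I. Y k \<omega> \<in> B k} = measure N2 {\<omega> \<in> space N2. \<forall>k\<in>I. Y k \<omega> \<in> B k}"
  using assms
proof (induction I arbitrary: N1 N2 rule: finite_induct)
  case empty
  then show ?case by (simp add: cis_conv_exp)
next
  case (insert i I)
  let ?E = "\<lambda>N. density N (indicator (Y i -` B i \<inter> space N))"
  have mN: "Y k \<in> borel_measurable N1" "Y k \<in> borel_measurable N2" if "k \<in> insert i I" for k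
    using insert.prems(4)[OF that] insert.prems(3) measurable_cong_sets by blast+
  have mea: "measure (?E N) {\<omega> \<in> space N. \<forall>k\<in>I. Y k \<omega> \<in> B k} = measure N {\<omega> \<in> space N. \<forall>k\<in>insert i I. Y k \<omega> \<in> B k}
      \<and> finite_measure (?E N)"
    if N: "finite_measure N" and m: "\<And>k. k \<in> insert i I \<Longrightarrow> Y k \<in> borel_measurable N" for N
  proof -
    have [measurable]: "Y i -` B i \<inter> space N \<in> sets N"
      using m[of i] insert.prems(6)[of i] by (simp add: measurable_sets)
    have I[measurable]: "{\<omega> \<in> space N. \<forall>k\<in>I. Y k \<omega> \<in> B k} \<in> sets N"
    proof (rule sets.sets_Collect_finite_All[OF _ insert.hyps(1)])
      fix k assume "k \<in> I"
      then have "Y k -` B k \<inter> space N \<in> sets N"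
        using m[of k] insert.prems(6)[of k] by (simp add: measurable_sets)
      also have "Y k -` B k \<inter> space N = {\<omega> \<in> space N. Y k \<omega> \<in> B k}" by auto
      finally show "{\<omega> \<in> space N. Y k \<omega> \<in> B k} \<in> sets N" .
    qed
    have "emeasure (?E N) {\<omega> \<in> space N. \<forall>k\<in>I. Y k \<omega> \<in> B k}
        = emeasure N ((Y i -` B i \<inter> space N) \<inter> {\<omega> \<in> space N. \<forall>k\<in>I. Y k \<omega> \<in> B k})"
      by (subst emeasure_density) (simp_all add: nn_integral_indicator flip: indicator_inter_arith)
    also have "(Y i -` B i \<inter> space N) \<inter> {\<omega> \<in> space N. \<forall>k\<in>I. Y k \<omega> \<in> B k} = {\<omega> \<in> space N. \<forall>k\<in>insert i I. Y k \<omega> \<in> B k}"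
      by auto
    finally have "measure (?E N) {\<omega> \<in> space N. \<forall>k\<in>I. Y k \<omega> \<in> B k} = measure N {\<omega> \<in> space N. \<forall>k\<in>insert i I. Y k \<omega> \<in> B k}"
      by (simp add: measure_def)
    moreover have "finite_measure (?E N)"
      using N by (intro finite_measureI) (auto simp: emeasure_density finite_measure.emeasure_finite)
    ultimately show ?thesis by simp
  qed
  have "measure (?E N1) {\<omega> \<in> space (?E N1). \<forall>k\<in>I. Y k \<omega> \<in> B k} = measure (?E N2) {\<omega> \<in> space (?E N2). \<forall>k\<in>I. Y k \<omega> \<in> B k}"
  proof (rule insert.IH)
    show "finite_measure (?E N1)" "finite_measure (?E N2)"
      using mea[OF insert.prems(1) mN(1)] mea[OF insert.prems(2) mN(2)] by auto
    show "(\<integral>\<omega>. cis (\<Sum>k\<in>I. a k * Y k \<omega>) \<partial>?E N1) = (\<integral>\<omega>. cis (\<Sum>k\<in>I. a k * Y k \<omega>) \<partial>?E N2)" for a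
    proof (rule integral_cis_indicator_eq)
      fix s b
      have "(\<Sum>k\<in>insert i I. (if k = i then s else b * a k) * Y k \<omega>) = s * Y i \<omega> + b * (\<Sum>k\<in>I. a k * Y k \<omega>)" for \<omega>
        using insert.hyps by (auto simp: sum_distrib_left mult.assoc intro!: sum.cong)
      then show "(\<integral>\<omega>. cis (s * Y i \<omega> + b * (\<Sum>k\<in>I. a k * Y k \<omega>)) \<partial>N1) = (\<integral>\<omega>. cis (s * Y i \<omega> + b * (\<Sum>k\<in>I. a k * Y k \<omega>)) \<partial>N2)"
        using insert.prems(5)[of "\<lambda>k. if k = i then s else b * a k"] by simp
    qed (use insert mN in auto)
  qed (use insert mN in auto)
  then show ?case
    using mea[OF insert.prems(1) mN(1)] mea[OF insert.prems(2) mN(2)] by simp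
qed

section \<open>Regression residuals of a Gaussian vector are independent\<close>

text \<open>The conclusion is the independence of \<open>X\<close> and the vector \<open>Y\<close>, phrased with product measures because
\<open>indep_var\<close> requires both variables to take values in the same type. The hypothesis says that the
joint law and the product of the marginals have the same trigonometric integrals.\<close>
lemma (in prob_space) distr_pair_PiM_if_integral_cis_mult:
  fixes X :: "'a \<Rightarrow> real" and Y :: "'i \<Rightarrow> 'a \<Rightarrow> real"
  assumes I: "finite I"
    and X[measurable]: "X \<in> borel_measurable M"
    and Y: "\<And>k. k \<in> I \<Longrightarrow> Y k \<in> borel_measurable M"
    and eq: "\<And>s a. expectation (\<lambda>\<omega>. cis (s * X \<omega> + (\<Sum>k\<in>I. a k * Y k \<omega>)))
      = expectation (\<lambda>\<omega>. cis (s * X \<omega>)) * expectation (\<lambda>\<omega>. cis (\<Sum>k\<in>I. a k * Y k \<omega>))"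
  shows "distr M borel X \<Otimes>\<^sub>M distr M (PiM I (\<lambda>_. borel)) (\<lambda>\<omega>. \<lambda>k\<in>I. Y k \<omega>)
    = distr M (borel \<Otimes>\<^sub>M PiM I (\<lambda>_. borel)) (\<lambda>\<omega>. (X \<omega>, \<lambda>k\<in>I. Y k \<omega>))"
proof -
  interpret MM: pair_prob_space M M by unfold_locales
  have Ym[measurable]: "(\<lambda>\<omega>. \<lambda>k\<in>I. Y k \<omega>) \<in> measurable M (PiM I (\<lambda>_. borel))"
    by (rule measurable_restrict) (rule Y)
  have rect: "prob ((X -` A \<inter> space M) \<inter> {\<omega> \<in> space M. \<forall>k\<in>I. Y k \<omega> \<in> B k})
      = prob (X -` A \<inter> space M) * prob {\<omega> \<in> space M. \<forall>k\<in>I. Y k \<omega> \<in> B k}"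
    if A: "A \<in> sets borel" and B: "\<And>k. k \<in> I \<Longrightarrow> B k \<in> sets borel" for A B
  proof -
    \<comment> \<open>The law of \<open>(X, Y)\<close> is read off the diagonal of \<open>M \<Otimes>\<^sub>M M\<close>, the product of the marginals off
      \<open>M \<Otimes>\<^sub>M M\<close> itself; the index \<open>None\<close> stands for \<open>X\<close>.\<close>
    define J where "J = insert None (Some ` I)"
    define Z where "Z = case_option (\<lambda>p. X (fst p)) (\<lambda>k p. Y k (snd p))"
    define C where "C = case_option A B"
    define diag where "diag = (\<lambda>\<omega>::'a. (\<omega>, \<omega>))"
    have [measurable]: "diag \<in> measurable M (M \<Otimes>\<^sub>M M)" unfolding diag_def by measurable
    interpret D: prob_space "distr M (M \<Otimes>\<^sub>M M) diag" by (rule prob_space_distr) simp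
    have ZJ: "(\<Sum>k\<in>J. a k * Z k p) = a None * X (fst p) + (\<Sum>k\<in>I. a (Some k) * Y k (snd p))" for a p
      using I unfolding J_def Z_def by (subst sum.insert) (auto simp: sum.reindex)
    have Zm: "Z k \<in> borel_measurable (M \<Otimes>\<^sub>M M)" if "k \<in> J" for k
      using that Y unfolding J_def Z_def by (auto intro!: measurable_compose[OF measurable_snd])
    have CJ: "(\<forall>k\<in>J. Z k p \<in> C k) \<longleftrightarrow> X (fst p) \<in> A \<and> (\<forall>k\<in>I. Y k (snd p) \<in> B k)" for p
      unfolding J_def Z_def C_def by auto
    have "measure (distr M (M \<Otimes>\<^sub>M M) diag) {p \<in> space (distr M (M \<Otimes>\<^sub>M M) diag). \<forall>k\<in>J. Z k p \<in> C k}
        = measure (M \<Otimes>\<^sub>M M) {p \<in> space (M \<Otimes>\<^sub>M M). \<forall>k\<in>J. Z k p \<in> C k}"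
    proof (rule finite_measure_rectangle_eq_if_integral_cis_eq)
      show "finite J" using I by (simp add: J_def)
      show "finite_measure (distr M (M \<Otimes>\<^sub>M M) diag)" "finite_measure (M \<Otimes>\<^sub>M M)"
        by unfold_locales
      show "Z k \<in> borel_measurable (distr M (M \<Otimes>\<^sub>M M) diag)" if "k \<in> J" for k
        using Zm[OF that] by simp
      show "C k \<in> sets borel" if "k \<in> J" for k
        using that A B unfolding J_def C_def by auto
      fix a
      define T where "T \<omega> = (\<Sum>k\<in>I. a (Some k) * Y k \<omega>)" for \<omega>
      have T[measurable]: "T \<in> borel_measurable M"
        unfolding T_def using Y by (intro borel_measurable_sum borel_measurable_times) auto
      have "(\<integral>p. cis (\<Sum>k\<in>J. a k * Z k p) \<partial>distr M (M \<Otimes>\<^sub>M M) diag)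
          = (\<integral>p. cis (a None * X (fst p) + T (snd p)) \<partial>distr M (M \<Otimes>\<^sub>M M) diag)"
        unfolding ZJ T_def ..
      also have "\<dots> = expectation (\<lambda>\<omega>. cis (a None * X \<omega> + T \<omega>))"
        by (subst integral_distr) (auto simp: diag_def cis_conv_exp)
      also have "\<dots> = expectation (\<lambda>\<omega>. cis (a None * X \<omega>)) * expectation (\<lambda>\<omega>. cis (T \<omega>))"
        unfolding T_def by (rule eq)
      also have "\<dots> = (\<integral>\<omega>. (\<integral>\<omega>'. cis (a None * X \<omega> + T \<omega>') \<partial>M) \<partial>M)"
        by (simp flip: cis_mult)
      also have "\<dots> = (\<integral>\<omega>. (\<integral>\<omega>'. cis (a None * X (fst (\<omega>, \<omega>')) + T (snd (\<omega>, \<omega>'))) \<partial>M) \<partial>M)"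
        by simp
      also have "\<dots> = (\<integral>p. cis (a None * X (fst p) + T (snd p)) \<partial>(M \<Otimes>\<^sub>M M))"
        by (intro MM.integral_fst' MM.P.integrable_cis) measurable
      also have "\<dots> = (\<integral>p. cis (\<Sum>k\<in>J. a k * Z k p) \<partial>(M \<Otimes>\<^sub>M M))"
        unfolding ZJ T_def ..
      finally show "(\<integral>p. cis (\<Sum>k\<in>J. a k * Z k p) \<partial>distr M (M \<Otimes>\<^sub>M M) diag)
          = (\<integral>p. cis (\<Sum>k\<in>J. a k * Z k p) \<partial>(M \<Otimes>\<^sub>M M))" .
    qed simp
    moreover have meas: "X -` A \<inter> space M \<in> events" "{\<omega> \<in> space M. \<forall>k\<in>I. Y k \<omega> \<in> B k} \<in> events"
    proof -
      show "X -` A \<inter> space M \<in> events" using A by measurable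
      show "{\<omega> \<in> space M. \<forall>k\<in>I. Y k \<omega> \<in> B k} \<in> events"
      proof (rule sets.sets_Collect_finite_All[OF _ I])
        fix k assume "k \<in> I"
        then have "Y k -` B k \<inter> space M \<in> sets M"
          using Y[of k] B[of k] by (simp add: measurable_sets)
        also have "Y k -` B k \<inter> space M = {\<omega> \<in> space M. Y k \<omega> \<in> B k}" by auto
        finally show "{\<omega> \<in> space M. Y k \<omega> \<in> B k} \<in> events" .
      qed
    qed
    moreover have sp: "{p \<in> space (M \<Otimes>\<^sub>M M). \<forall>k\<in>J. Z k p \<in> C k}
        = (X -` A \<inter> space M) \<times> {\<omega> \<in> space M. \<forall>k\<in>I. Y k \<omega> \<in> B k}"
      unfolding CJ by (auto simp: space_pair_measure)
    moreover have "diag -` ((X -` A \<inter> space M) \<times> {\<omega> \<in> space M. \<forall>k\<in>I. Y k \<omega> \<in> B k}) \<inter> space M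
        = (X -` A \<inter> space M) \<inter> {\<omega> \<in> space M. \<forall>k\<in>I. Y k \<omega> \<in> B k}"
      unfolding diag_def by auto
    ultimately show ?thesis
      by (simp add: measure_distr) (simp add: measure_def emeasure_pair_measure_Times enn2real_mult)
  qed
  define R where "R = (\<lambda>\<omega>. \<lambda>k\<in>I. Y k \<omega>)"
  let ?A = "{X -` A \<inter> space M | A. A \<in> sets (borel :: real measure)}"
  let ?P = "prod_algebra I (\<lambda>_. borel :: real measure)"
  let ?C = "{R -` C \<inter> space M | C. C \<in> ?P}"
  let ?S = "{R -` C \<inter> space M | C. C \<in> sets (PiM I (\<lambda>_. borel :: real measure))}"
  have Rm[measurable]: "R \<in> measurable M (PiM I (\<lambda>_. borel))" unfolding R_def by (rule Ym)
  have PS: "?P \<subseteq> sets (PiM I (\<lambda>_. borel))" unfolding sets_PiM by auto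
  have "indep_set ?A ?C"
  proof (rule indep_setI)
    show "?A \<subseteq> events" by auto
    show "?C \<subseteq> events" using measurable_sets[OF Rm] PS by blast
    fix U V assume "U \<in> ?A" "V \<in> ?C"
    then obtain A C where A: "A \<in> sets borel" "U = X -` A \<inter> space M"
      and C: "C \<in> ?P" "V = R -` C \<inter> space M" by blast
    from C(1) obtain B where B: "C = (\<Pi>\<^sub>E i\<in>I. B i)" "\<And>k. k \<in> I \<Longrightarrow> B k \<in> sets borel"
      unfolding prod_algebra_eq_finite[OF I] by auto
    have V: "V = {\<omega> \<in> space M. \<forall>k\<in>I. Y k \<omega> \<in> B k}"
      unfolding C B R_def by (auto simp: PiE_iff)
    show "prob (U \<inter> V) = prob U * prob V"
      unfolding V A by (rule rect) (use A B in auto)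
  qed
  moreover have "Int_stable ?A"
  proof (rule Int_stableI)
    fix a b assume "a \<in> ?A" "b \<in> ?A"
    then obtain c d where "c \<in> sets borel" "d \<in> sets borel" "a = X -` c \<inter> space M" "b = X -` d \<inter> space M" by blast
    then show "a \<inter> b \<in> ?A"
      by (auto intro!: exI[of _ "c \<inter> d"])
  qed
  moreover have "Int_stable ?C"
  proof (rule Int_stableI)
    fix a b assume "a \<in> ?C" "b \<in> ?C"
    then obtain c d where "c \<in> ?P" "d \<in> ?P" "a = R -` c \<inter> space M" "b = R -` d \<inter> space M" by blast
    then show "a \<inter> b \<in> ?C"
      using Int_stable_prod_algebra[of I "\<lambda>_. borel :: real measure"] unfolding Int_stable_def
      by (auto intro!: exI[of _ "c \<inter> d"])
  qed
  ultimately have ind: "indep_set (sigma_sets (space M) ?A) (sigma_sets (space M) ?C)"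
    by (rule indep_set_sigma_sets)
  have "sigma_sets (space M) ?C = ?S"
    unfolding sets_PiM
    by (rule sigma_sets_vimage_commute[symmetric]) (use measurable_space[OF Rm] in \<open>auto simp: space_PiM\<close>)
  with ind have ind: "indep_set (sigma_sets (space M) ?A) ?S" by simp
  have "distr M borel X \<Otimes>\<^sub>M distr M (PiM I (\<lambda>_. borel)) R
    = distr M (borel \<Otimes>\<^sub>M PiM I (\<lambda>_. borel)) (\<lambda>\<omega>. (X \<omega>, R \<omega>))"
  proof (rule pair_measure_eqI)
    interpret X: prob_space "distr M borel X" by (rule prob_space_distr) simp
    interpret R: prob_space "distr M (PiM I (\<lambda>_. borel)) R" by (rule prob_space_distr) simp
    show "sigma_finite_measure (distr M borel X)" "sigma_finite_measure (distr M (PiM I (\<lambda>_. borel)) R)"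
      by unfold_locales
    show "sets (distr M borel X \<Otimes>\<^sub>M distr M (PiM I (\<lambda>_. borel)) R)
      = sets (distr M (borel \<Otimes>\<^sub>M PiM I (\<lambda>_. borel)) (\<lambda>\<omega>. (X \<omega>, R \<omega>)))"
      by (simp cong: sets_pair_measure_cong)
    fix A C assume "A \<in> sets (distr M borel X)" "C \<in> sets (distr M (PiM I (\<lambda>_. borel)) R)"
    then have A[measurable]: "A \<in> sets borel" and C[measurable]: "C \<in> sets (PiM I (\<lambda>_. borel))" by auto
    have "prob ((X -` A \<inter> space M) \<inter> (R -` C \<inter> space M)) = prob (X -` A \<inter> space M) * prob (R -` C \<inter> space M)"
      by (rule indep_setD[OF ind]) (use A C in \<open>auto intro!: sigma_sets.Basic\<close>)
    moreover have "(\<lambda>\<omega>. (X \<omega>, R \<omega>)) -` (A \<times> C) \<inter> space M = (X -` A \<inter> space M) \<inter> (R -` C \<inter> space M)"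
      by auto
    ultimately show "emeasure (distr M borel X) A * emeasure (distr M (PiM I (\<lambda>_. borel)) R) C
      = emeasure (distr M (borel \<Otimes>\<^sub>M PiM I (\<lambda>_. borel)) (\<lambda>\<omega>. (X \<omega>, R \<omega>))) (A \<times> C)"
      by (simp add: emeasure_distr emeasure_eq_measure ennreal_mult)
  qed
  then show ?thesis unfolding R_def .
qed

text \<open>A mean of zero forces the location parameter to vanish, also for a degenerate law.
The formulas for second moment and characteristic function then cover both cases at once.\<close>
lemma (in prob_space) centered_gaussian_rv:
  assumes g: "gaussian_rv M Y" and mean: "expectation Y = 0"
  shows "integrable M (\<lambda>\<omega>. (Y \<omega>)\<^sup>2)"
    and "expectation (\<lambda>\<omega>. cis (Y \<omega>)) = of_real (exp (- expectation (\<lambda>\<omega>. (Y \<omega>)\<^sup>2) / 2))"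
    and "expectation (\<lambda>\<omega>. (Y \<omega>)\<^sup>2) > 0 \<Longrightarrow>
      distributed M lborel Y (normal_density 0 (sqrt (expectation (\<lambda>\<omega>. (Y \<omega>)\<^sup>2))))"
proof -
  have [measurable]: "Y \<in> borel_measurable M" using g by (simp add: gaussian_rv_def)
  have "integrable M (\<lambda>\<omega>. (Y \<omega>)\<^sup>2) \<and>
    expectation (\<lambda>\<omega>. cis (Y \<omega>)) = of_real (exp (- expectation (\<lambda>\<omega>. (Y \<omega>)\<^sup>2) / 2)) \<and>
    (expectation (\<lambda>\<omega>. (Y \<omega>)\<^sup>2) > 0 \<longrightarrow> distributed M lborel Y (normal_density 0 (sqrt (expectation (\<lambda>\<omega>. (Y \<omega>)\<^sup>2)))))"
  proof -
    from g consider (normal) \<mu> s where "s > 0" "distributed M lborel Y (normal_density \<mu> s)"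
      | (const) \<mu> where "AE \<omega> in M. Y \<omega> = \<mu>"
      unfolding gaussian_rv_def by blast
    then show ?thesis
    proof cases
      case (normal \<mu> s)
      have \<mu>: "\<mu> = 0" using normal_distributed_expectation[OF normal] mean by simp
      have D: "distributed M lborel Y (normal_density 0 s)" using normal \<mu> by simp
      have var: "expectation (\<lambda>\<omega>. (Y \<omega>)\<^sup>2) = s\<^sup>2"
        using normal_distributed_variance[OF normal(1) D] mean by simp
      have 1: "integrable M (\<lambda>\<omega>. (Y \<omega>)\<^sup>2)"
        using integrable_normal_moment[OF normal(1), of 0 2]
          distributed_integrable[OF D, of "\<lambda>x. x\<^sup>2"] by simp
      have "distributed M lborel (\<lambda>\<omega>. (Y \<omega> - 0) / s) std_normal_density"
        using D normal_standard_normal_convert[OF normal(1)] by blast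
      then have std: "distr M lborel (\<lambda>\<omega>. Y \<omega> / s) = std_normal_distribution"
        by (simp add: distributed_distr_eq_density)
      have "char std_normal_distribution s = (\<integral>\<omega>. iexp (s * (Y \<omega> / s)) \<partial>M)"
        unfolding char_def std[symmetric] by (subst integral_distr) auto
      then have "expectation (\<lambda>\<omega>. cis (Y \<omega>)) = of_real (exp (- (s\<^sup>2) / 2))"
        using normal(1) by (simp add: char_std_normal_distribution cis_conv_exp)
      then show ?thesis using 1 D var normal(1) by simp
    next
      case const
      have "expectation Y = expectation (\<lambda>_. \<mu>)" by (rule integral_cong_AE) (use const in auto)
      then have "\<mu> = 0" using mean by (simp add: prob_space)
      then have Y0: "AE \<omega> in M. Y \<omega> = 0" using const by simp
      have 1: "expectation (\<lambda>\<omega>. (Y \<omega>)\<^sup>2) = expectation (\<lambda>_. 0)"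
        by (rule integral_cong_AE) (use Y0 in auto)
      have 2: "expectation (\<lambda>\<omega>. cis (Y \<omega>)) = expectation (\<lambda>_. 1)"
        by (rule integral_cong_AE) (use Y0 in \<open>auto simp: cis_conv_exp\<close>)
      have 3: "integrable M (\<lambda>\<omega>. (Y \<omega>)\<^sup>2)"
        by (subst integrable_cong_AE[where g = "\<lambda>_. 0"]) (use Y0 in auto)
      show ?thesis using 1 2 3 by (simp add: prob_space)
    qed
  qed
  then show "integrable M (\<lambda>\<omega>. (Y \<omega>)\<^sup>2)"
    and "expectation (\<lambda>\<omega>. cis (Y \<omega>)) = of_real (exp (- expectation (\<lambda>\<omega>. (Y \<omega>)\<^sup>2) / 2))"
    and "expectation (\<lambda>\<omega>. (Y \<omega>)\<^sup>2) > 0 \<Longrightarrow>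
      distributed M lborel Y (normal_density 0 (sqrt (expectation (\<lambda>\<omega>. (Y \<omega>)\<^sup>2))))"
    by blast+
qed

lemma (in prob_space) integrable_mult_if_square_integrable:
  fixes X Y :: "'a \<Rightarrow> real"
  assumes [measurable]: "X \<in> borel_measurable M" "Y \<in> borel_measurable M"
    and "integrable M (\<lambda>\<omega>. (X \<omega>)\<^sup>2)" "integrable M (\<lambda>\<omega>. (Y \<omega>)\<^sup>2)"
  shows "integrable M (\<lambda>\<omega>. X \<omega> * Y \<omega>)"
proof (rule Bochner_Integration.integrable_bound)
  show "integrable M (\<lambda>\<omega>. (X \<omega>)\<^sup>2 + (Y \<omega>)\<^sup>2)" using assms by simp
  have "\<bar>x * y\<bar> \<le> x\<^sup>2 + y\<^sup>2" for x y :: real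
  proof -
    have "2 * (\<bar>x\<bar> * \<bar>y\<bar>) \<le> x\<^sup>2 + y\<^sup>2" using sum_squares_bound[of "\<bar>x\<bar>" "\<bar>y\<bar>"] by (simp add: mult.assoc)
    moreover have "0 \<le> \<bar>x\<bar> * \<bar>y\<bar>" by simp
    ultimately show ?thesis unfolding abs_mult by linarith
  qed
  then show "AE \<omega> in M. norm (X \<omega> * Y \<omega>) \<le> norm ((X \<omega>)\<^sup>2 + (Y \<omega>)\<^sup>2)" by simp
qed simp

lemma (in prob_space) zero_mean_gaussian_vector_linear_combination:
  assumes X: "zero_mean_gaussian_vector M I X" and I: "finite I"
  shows "gaussian_rv M (\<lambda>\<omega>. \<Sum>j\<in>I. a j * X j \<omega>)"
    and "expectation (\<lambda>\<omega>. \<Sum>j\<in>I. a j * X j \<omega>) = 0"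
    and "j \<in> I \<Longrightarrow> gaussian_rv M (X j)"
proof -
  show "gaussian_rv M (\<lambda>\<omega>. \<Sum>j\<in>I. a j * X j \<omega>)" for a
    using X by (simp add: zero_mean_gaussian_vector_def gaussian_vector_def)
  note g = this
  have [measurable]: "X j \<in> borel_measurable M" if "j \<in> I" for j
    using X that by (simp add: zero_mean_gaussian_vector_def gaussian_vector_def)
  show gj: "gaussian_rv M (X j)" if "j \<in> I" for j
  proof -
    have "(\<Sum>k\<in>I. (if k = j then 1 else 0) * X k \<omega>) = X j \<omega>" for \<omega>
      using I that by (simp add: if_distrib[of "\<lambda>c. c * _"] cong: if_cong)
    then show ?thesis using g[of "\<lambda>k. if k = j then 1 else 0"] by simp
  qed
  have m: "expectation (X j) = 0" if "j \<in> I" for j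
    using X that by (simp add: zero_mean_gaussian_vector_def)
  have "integrable M (X j)" if j: "j \<in> I" for j
    using integrable_mult_if_square_integrable[of "X j" "\<lambda>_. 1"] centered_gaussian_rv(1)[OF gj[OF j] m[OF j]] j by simp
  then show "expectation (\<lambda>\<omega>. \<Sum>j\<in>I. a j * X j \<omega>) = 0"
    using m by (simp add: Bochner_Integration.integral_sum)
qed

text \<open>The residuals are uncorrelated with \<open>X j\<close>. A linear combination of \<open>X j\<close> and the residuals is
therefore a centred Gaussian variable whose variance is the sum of the variances of the two parts, so
its characteristic function factorises.\<close>
lemma (in prob_space) gaussian_regression_residuals_indep:
  assumes X: "zero_mean_gaussian_vector M I X" and I: "finite I" and j: "j \<in> I"
    and v: "expectation (\<lambda>\<omega>. (X j \<omega>)\<^sup>2) \<noteq> 0"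
  defines "R \<equiv> \<lambda>\<omega>. \<lambda>k\<in>I. X k \<omega> - expectation (\<lambda>\<omega>. X k \<omega> * X j \<omega>) / expectation (\<lambda>\<omega>. (X j \<omega>)\<^sup>2) * X j \<omega>"
  shows "distr M borel (X j) \<Otimes>\<^sub>M distr M (PiM I (\<lambda>_. borel)) R
    = distr M (borel \<Otimes>\<^sub>M PiM I (\<lambda>_. borel)) (\<lambda>\<omega>. (X j \<omega>, R \<omega>))"
  unfolding R_def
proof (rule distr_pair_PiM_if_integral_cis_mult)
  have m: "X k \<in> borel_measurable M" if "k \<in> I" for k
    using X that by (simp add: zero_mean_gaussian_vector_def gaussian_vector_def)
  define c where "c k = expectation (\<lambda>\<omega>. X k \<omega> * X j \<omega>) / expectation (\<lambda>\<omega>. (X j \<omega>)\<^sup>2)" for k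
  define Y where "Y k \<omega> = X k \<omega> - c k * X j \<omega>" for k \<omega>
  have lin: "s * X j \<omega> + (\<Sum>k\<in>I. a k * Y k \<omega>)
      = (\<Sum>k\<in>I. (a k + (if k = j then s - (\<Sum>k\<in>I. a k * c k) else 0)) * X k \<omega>)" for s a \<omega>
    using I j by (simp add: Y_def algebra_simps sum.distrib sum_subtractf sum_distrib_left
        if_distrib[of "\<lambda>c. c * _"] if_distrib[of "\<lambda>c. _ * c"] cong: if_cong)
  note gl = zero_mean_gaussian_vector_linear_combination[OF X I]
  have g: "gaussian_rv M (\<lambda>\<omega>. s * X j \<omega> + (\<Sum>k\<in>I. a k * Y k \<omega>))"
    "expectation (\<lambda>\<omega>. s * X j \<omega> + (\<Sum>k\<in>I. a k * Y k \<omega>)) = 0" for s a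
    unfolding lin by (rule gl)+
  have mean: "expectation (X k) = 0" if "k \<in> I" for k
    using X that by (simp add: zero_mean_gaussian_vector_def)
  have sq: "integrable M (\<lambda>\<omega>. (X k \<omega>)\<^sup>2)" if "k \<in> I" for k
    using centered_gaussian_rv(1)[OF gl(3)[OF that] mean[OF that]] .
  have Ym: "Y k \<in> borel_measurable M" if "k \<in> I" for k
    unfolding Y_def using m[OF that] m[OF j] by measurable
  have prodX: "integrable M (\<lambda>\<omega>. X k \<omega> * X j \<omega>)" if "k \<in> I" for k
    using integrable_mult_if_square_integrable[OF m[OF that] m[OF j] sq[OF that] sq[OF j]] .
  have XY: "integrable M (\<lambda>\<omega>. Y k \<omega> * X j \<omega>)" "expectation (\<lambda>\<omega>. Y k \<omega> * X j \<omega>) = 0" if "k \<in> I" for k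
  proof -
    have e: "(\<lambda>\<omega>. Y k \<omega> * X j \<omega>) = (\<lambda>\<omega>. X k \<omega> * X j \<omega> - c k * (X j \<omega>)\<^sup>2)"
      by (simp add: Y_def algebra_simps power2_eq_square)
    show "integrable M (\<lambda>\<omega>. Y k \<omega> * X j \<omega>)" unfolding e using prodX[OF that] sq[OF j] by simp
    show "expectation (\<lambda>\<omega>. Y k \<omega> * X j \<omega>) = 0"
      unfolding e using prodX[OF that] sq[OF j] v by (simp add: c_def)
  qed
  show "expectation (\<lambda>\<omega>. cis (s * X j \<omega> + (\<Sum>k\<in>I. a k * Y k \<omega>)))
    = expectation (\<lambda>\<omega>. cis (s * X j \<omega>)) * expectation (\<lambda>\<omega>. cis (\<Sum>k\<in>I. a k * Y k \<omega>))" for s a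
  proof -
    define T where "T = (\<lambda>\<omega>. \<Sum>k\<in>I. a k * Y k \<omega>)"
    have gT: "gaussian_rv M T" "expectation T = 0" using g[of 0 a] by (simp_all add: T_def)
    have gX: "gaussian_rv M (\<lambda>\<omega>. s * X j \<omega>)" "expectation (\<lambda>\<omega>. s * X j \<omega>) = 0"
      using g[of s "\<lambda>_. 0"] by simp_all
    have gS: "gaussian_rv M (\<lambda>\<omega>. s * X j \<omega> + T \<omega>)" "expectation (\<lambda>\<omega>. s * X j \<omega> + T \<omega>) = 0"
      using g[of s a] by (simp_all add: T_def)
    have TX: "integrable M (\<lambda>\<omega>. T \<omega> * X j \<omega>)" "expectation (\<lambda>\<omega>. T \<omega> * X j \<omega>) = 0"
      unfolding T_def sum_distrib_right using XY
      by (auto simp: mult.assoc intro!: Bochner_Integration.integrable_sum)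
    have "(s * X j \<omega> + T \<omega>)\<^sup>2 = (s * X j \<omega>)\<^sup>2 + (T \<omega>)\<^sup>2 + 2 * s * (T \<omega> * X j \<omega>)" for \<omega>
      by (simp add: power2_eq_square algebra_simps)
    then have "expectation (\<lambda>\<omega>. (s * X j \<omega> + T \<omega>)\<^sup>2)
        = expectation (\<lambda>\<omega>. (s * X j \<omega>)\<^sup>2) + expectation (\<lambda>\<omega>. (T \<omega>)\<^sup>2)"
      using TX centered_gaussian_rv(1)[OF gT] centered_gaussian_rv(1)[OF gX] by simp
    then have "exp (- expectation (\<lambda>\<omega>. (s * X j \<omega> + T \<omega>)\<^sup>2) / 2)
        = exp (- expectation (\<lambda>\<omega>. (s * X j \<omega>)\<^sup>2) / 2) * exp (- expectation (\<lambda>\<omega>. (T \<omega>)\<^sup>2) / 2)"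
      by (simp add: exp_add[symmetric] add_divide_distrib)
    then have "expectation (\<lambda>\<omega>. cis (s * X j \<omega> + T \<omega>))
        = expectation (\<lambda>\<omega>. cis (s * X j \<omega>)) * expectation (\<lambda>\<omega>. cis (T \<omega>))"
      unfolding centered_gaussian_rv(2)[OF gT] centered_gaussian_rv(2)[OF gX] centered_gaussian_rv(2)[OF gS]
        of_real_mult[symmetric] of_real_eq_iff .
    then show ?thesis by (simp add: T_def)
  qed
  show "Y k \<in> borel_measurable M" if "k \<in> I" for k by (rule Ym[OF that])
qed (use I j X in \<open>simp_all add: zero_mean_gaussian_vector_def gaussian_vector_def\<close>)

section \<open>Estimates for the normal density\<close>

text \<open>Mills' ratio. With \<open>n\<close> the density, \<open>- (s\<^sup>2 / y) * n y\<close> is a primitive of \<open>n y * (1 + s\<^sup>2 / y\<^sup>2)\<close>,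
and \<open>1 + s\<^sup>2 / y\<^sup>2\<close> is at most \<open>1 + s\<^sup>2 / x\<^sup>2\<close> beyond \<open>x\<close>.\<close>
lemma mills_ratio_normal_density:
  assumes x: "x > 0" and s: "s > 0"
  shows "ennreal (x * normal_density 0 s x)
    \<le> ennreal (x\<^sup>2 / s\<^sup>2 + 1) * (\<integral>\<^sup>+y. ennreal (normal_density 0 s y) * indicator {x<..} y \<partial>lborel)"
proof -
  define n where "n = normal_density 0 s"
  have n0: "n y \<ge> 0" for y by (simp add: n_def)
  have "((\<lambda>y. - (s\<^sup>2 / y) * n y) has_real_derivative n y * (1 + s\<^sup>2 / y\<^sup>2)) (at y)" if "x \<le> y" for y
  proof -
    have "(n has_real_derivative - (y / s\<^sup>2) * n y) (at y)"
      unfolding n_def normal_density_def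
      by (rule derivative_eq_intros refl | use s in \<open>simp add: power2_eq_square\<close>)+
    then have "((\<lambda>y. - (s\<^sup>2 / y) * n y) has_real_derivative
        (s\<^sup>2 / y\<^sup>2) * n y + (- (s\<^sup>2 / y)) * (- (y / s\<^sup>2) * n y)) (at y)"
      using x s that by (auto intro!: derivative_eq_intros simp: power2_eq_square field_simps)
    then show ?thesis using x s that by (simp add: power2_eq_square distrib_left mult.commute add.commute)
  qed
  moreover have "((\<lambda>y. - (s\<^sup>2 / y) * n y) \<longlongrightarrow> 0) at_top"
  proof (rule Lim_null_comparison)
    show "\<forall>\<^sub>F y in at_top. norm (- (s\<^sup>2 / y) * n y) \<le> (s\<^sup>2 / sqrt (2 * pi * s\<^sup>2)) * (1 / y)"
      using eventually_gt_at_top[of 0]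
    proof eventually_elim
      case (elim y)
      then have "sqrt (2 * pi * s\<^sup>2) * y > 0" using s by simp
      with elim show ?case
        unfolding n_def normal_density_def by (auto simp: abs_mult divide_simps s)
    qed
    show "((\<lambda>y. s\<^sup>2 / sqrt (2 * pi * s\<^sup>2) * (1 / y)) \<longlongrightarrow> 0) at_top"
      by (intro tendsto_mult_right_zero tendsto_divide_0[OF tendsto_const]
          filterlim_at_top_imp_at_infinity filterlim_ident)
  qed
  ultimately have "(\<integral>\<^sup>+y. ennreal (n y * (1 + s\<^sup>2 / y\<^sup>2)) * indicator {x..} y \<partial>lborel) = ennreal (0 - (- (s\<^sup>2 / x) * n x))"
    by (intro nn_integral_FTC_atLeast) (auto simp: n_def intro!: mult_nonneg_nonneg)
  then have "ennreal ((s\<^sup>2 / x) * n x) = (\<integral>\<^sup>+y. ennreal (n y * (1 + s\<^sup>2 / y\<^sup>2)) * indicator {x..} y \<partial>lborel)"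
    by simp
  also have "\<dots> \<le> (\<integral>\<^sup>+y. ennreal (1 + s\<^sup>2 / x\<^sup>2) * (ennreal (n y) * indicator {x<..} y) \<partial>lborel)"
  proof (rule nn_integral_mono_AE)
    show "AE y in lborel. ennreal (n y * (1 + s\<^sup>2 / y\<^sup>2)) * indicator {x..} y
        \<le> ennreal (1 + s\<^sup>2 / x\<^sup>2) * (ennreal (n y) * indicator {x<..} y)"
      using AE_lborel_singleton[of x]
    proof eventually_elim
      case (elim y)
      show ?case
      proof (cases "y > x")
        case True
        then have "s\<^sup>2 / y\<^sup>2 \<le> s\<^sup>2 / x\<^sup>2"
          using x by (intro divide_left_mono power_mono) auto
        then have "n y * (1 + s\<^sup>2 / y\<^sup>2) \<le> (1 + s\<^sup>2 / x\<^sup>2) * n y"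
          using n0[of y] by (simp add: mult.commute mult_left_mono)
        then show ?thesis using True n0 by (simp add: ennreal_mult[symmetric] del: ennreal_plus)
      qed (use elim in auto)
    qed
  qed
  also have "\<dots> = ennreal (1 + s\<^sup>2 / x\<^sup>2) * (\<integral>\<^sup>+y. ennreal (n y) * indicator {x<..} y \<partial>lborel)"
    by (rule nn_integral_cmult) (simp add: n_def)
  finally have "ennreal (x\<^sup>2 / s\<^sup>2) * ennreal ((s\<^sup>2 / x) * n x)
    \<le> ennreal (x\<^sup>2 / s\<^sup>2) * (ennreal (1 + s\<^sup>2 / x\<^sup>2) * (\<integral>\<^sup>+y. ennreal (n y) * indicator {x<..} y \<partial>lborel))"
    by (rule mult_left_mono) simp
  moreover have "ennreal (x\<^sup>2 / s\<^sup>2) * ennreal ((s\<^sup>2 / x) * n x) = ennreal (x * n x)"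
    using x s by (simp add: ennreal_mult'[symmetric] power2_eq_square)
  moreover have "ennreal (x\<^sup>2 / s\<^sup>2) * ennreal (1 + s\<^sup>2 / x\<^sup>2) = ennreal (x\<^sup>2 / s\<^sup>2 + 1)"
    using x s by (simp add: ennreal_mult'[symmetric] distrib_left del: ennreal_plus)
  ultimately show ?thesis by (simp add: n_def mult.assoc[symmetric] del: ennreal_plus)
qed

text \<open>In terms of \<open>r = x / s\<close> the left side is \<open>r * exp (- r\<^sup>2 / 2) / sqrt (2 * pi)\<close>, which
decreases for \<open>r \<ge> 1\<close>; the right side is its value at \<open>r = sqrt L\<close>.\<close>
lemma normal_density_far_tail_le:
  assumes x: "x > 0" and s: "s > 0" and L: "L \<ge> 1" and far: "L \<le> x\<^sup>2 / s\<^sup>2"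
  shows "x * normal_density 0 s x \<le> sqrt (L / (2 * pi)) * exp (- L / 2)"
proof -
  define r where "r = x / s"
  define q where "q = sqrt L"
  have r: "r > 0" and r2: "r\<^sup>2 = x\<^sup>2 / s\<^sup>2" using x s by (auto simp: r_def power_divide)
  have q: "q \<ge> 1" "q\<^sup>2 = L" using L by (auto simp: q_def)
  have qr: "q \<le> r" using far r r2 by (metis q(2) less_imp_le power2_le_imp_le)
  have "r - q \<le> q * ((r\<^sup>2 - q\<^sup>2) / 2)"
  proof -
    have "2 \<le> q * (r + q)" using q qr mult_mono[of 1 q 2 "r + q"] by linarith
    then have "(r - q) * 2 \<le> (r - q) * (q * (r + q))" using qr by (intro mult_left_mono) auto
    also have "(r - q) * (q * (r + q)) = q * (r\<^sup>2 - q\<^sup>2)" by (simp add: power2_eq_square algebra_simps)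
    finally show ?thesis by simp
  qed
  then have "r \<le> q * (1 + (r\<^sup>2 - q\<^sup>2) / 2)" by (simp add: distrib_left)
  also have "\<dots> \<le> q * exp ((r\<^sup>2 - q\<^sup>2) / 2)"
    using q exp_ge_add_one_self by (intro mult_left_mono) auto
  finally have "r * exp (- r\<^sup>2 / 2) \<le> q * exp ((r\<^sup>2 - q\<^sup>2) / 2) * exp (- r\<^sup>2 / 2)"
    by (rule mult_right_mono) simp
  also have "\<dots> = q * exp (- L / 2)"
    by (simp add: exp_add[symmetric] q(2)[symmetric] field_simps)
  finally have "r * exp (- r\<^sup>2 / 2) / sqrt (2 * pi) \<le> q * exp (- L / 2) / sqrt (2 * pi)"
    by (rule divide_right_mono) simp
  moreover have "x * normal_density 0 s x = r * exp (- r\<^sup>2 / 2) / sqrt (2 * pi)"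
    using s unfolding r2 unfolding normal_density_def r_def
    by (simp add: real_sqrt_mult mult.commute)
  ultimately show ?thesis by (simp add: q_def real_sqrt_divide)
qed

text \<open>By Mills' ratio this shows that more than five percent of the standard normal mass lies above
\<open>1.437\<close>.\<close>
lemma std_normal_density_quantile_bound: "1437 / 1000 * std_normal_density (1437 / 1000) > (5/100) * ((1437/1000)\<^sup>2 + 1)"
proof -
  have "exp (1 + 13/400) = exp 1 * exp (13/400::real)" by (rule exp_add)
  also have "\<dots> \<le> (272/100) * (1 + 13/400 + (13/400)\<^sup>2)"
    using e_less_272 exp_bound[of "13/400"] by (intro mult_mono) auto
  finally have e: "exp (1 + 13/400) \<le> (282/100::real)" by (simp add: power2_eq_square)
  have "(1437/1000)\<^sup>2 / 2 \<le> (1 + 13/400::real)" by (simp add: power2_eq_square)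
  then have "exp ((1437/1000)\<^sup>2 / 2) \<le> exp (1 + 13/400::real)" by simp
  with e have e2: "exp ((1437/1000)\<^sup>2 / 2) \<le> (282/100::real)" by linarith
  have "sqrt (2 * pi) \<le> 2829/1000"
    using pi_less_4 by (intro real_le_lsqrt) (auto simp: power2_eq_square)
  then have "sqrt (2 * pi) * exp ((1437/1000)\<^sup>2 / 2) \<le> 2829/1000 * (282/100)"
    using e2 by (intro mult_mono) auto
  then have "1 / (2829/1000 * (282/100)) \<le> 1 / (sqrt (2 * pi) * exp ((1437/1000)\<^sup>2 / 2))"
    by (intro divide_left_mono) (auto intro!: mult_pos_pos)
  also have "\<dots> = std_normal_density (1437/1000)"
    by (simp add: std_normal_density_def exp_minus field_simps)
  finally show ?thesis by (simp add: power2_eq_square)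
qed

section \<open>Facets and their shadows\<close>

text \<open>Ties between coordinates are broken by the order of the index set: \<open>j\<close> is the least index at which a
family \<open>x\<close> is maximal iff \<open>tie_le k j (x k) (x j)\<close> for all \<open>k\<close>. This also separates
coordinates that coincide almost surely.\<close>
definition tie_le :: "'i::linorder \<Rightarrow> 'i \<Rightarrow> real \<Rightarrow> real \<Rightarrow> bool" where
  "tie_le k j a b \<longleftrightarrow> (if k < j then a < b else a \<le> b)"

lemma tie_le_diff_iff: "tie_le k j (a - c) (b - c) \<longleftrightarrow> tie_le k j a b"
  by (simp add: tie_le_def)

text \<open>Chaining the two inequalities gives \<open>p \<le> c' * q \<le> c' * c * p \<le> p\<close>, and the tie-breaking makes
one of these steps strict.\<close>
lemma tie_le_shadow_disjoint:
  fixes p q c c' :: real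
  assumes "j \<noteq> k" "p > 0" "q > 0" "c * c' \<le> 1"
    and qp: "tie_le k j q (c * p)" and pq: "tie_le j k p (c' * q)"
  shows False
proof -
  have le: "q \<le> c * p" "p \<le> c' * q"
    using qp pq by (auto simp: tie_le_def split: if_splits)
  then have "0 < c * p" "0 < c' * q" using assms(2,3) by linarith+
  then have pos: "c > 0" "c' > 0"
    using assms(2,3) zero_less_mult_pos2 by blast+
  have "c' * (c * p) \<le> p"
    using mult_right_mono[OF assms(4), of p] assms(2) by (simp add: mult.assoc mult.left_commute)
  moreover have "c' * q \<le> c' * (c * p)" using le pos by simp
  moreover have "k < j \<Longrightarrow> c' * q < c' * (c * p)" using qp pos by (simp add: tie_le_def)
  moreover have "j < k \<Longrightarrow> p < c' * q" using pq by (simp add: tie_le_def)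
  ultimately show False using le \<open>j \<noteq> k\<close> by (cases j k rule: linorder_cases) auto
qed

locale zero_mean_gaussian_family = prob_space M
  for M :: "'a measure" +
  fixes I :: "'i::linorder set" and X :: "'i \<Rightarrow> 'a \<Rightarrow> real"
  assumes finite_index: "finite I"
    and gaussian: "zero_mean_gaussian_vector M I X"
begin

definition var :: "'i \<Rightarrow> real" where
  "var j = expectation (\<lambda>\<omega>. (X j \<omega>)\<^sup>2)"

text \<open>The coefficient of \<open>X j\<close> in the linear regression of \<open>X k\<close> on \<open>X j\<close>.\<close>
definition reg :: "'i \<Rightarrow> 'i \<Rightarrow> real" where
  "reg j k = expectation (\<lambda>\<omega>. X k \<omega> * X j \<omega>) / var j"

definition residual :: "'i \<Rightarrow> 'i \<Rightarrow> 'a \<Rightarrow> real" where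
  "residual j k \<omega> = X k \<omega> - reg j k * X j \<omega>"

text \<open>Think of the part of the hyperplane \<open>X j = x\<close> on which \<open>j\<close> is the least index of the maximum.
Since \<open>X k = residual j k + reg j k * X j\<close>, membership in it is a condition on the residuals alone,
and \<open>facet j x\<close> is the event that they satisfy it, whatever the value of \<open>X j\<close>.\<close>
definition facet :: "'i \<Rightarrow> real \<Rightarrow> 'a set" where
  "facet j x = {\<omega> \<in> space M. \<forall>k\<in>I. tie_le k j (residual j k \<omega>) ((1 - reg j k) * x)}"

abbreviation dens :: "'i \<Rightarrow> real \<Rightarrow> real" where
  "dens j \<equiv> normal_density 0 (sqrt (var j))"

lemma X_measurable: "j \<in> I \<Longrightarrow> X j \<in> borel_measurable M"
  using gaussian by (simp add: zero_mean_gaussian_vector_def gaussian_vector_def)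

lemma X_gaussian: "j \<in> I \<Longrightarrow> gaussian_rv M (X j)"
  by (rule zero_mean_gaussian_vector_linear_combination(3)[OF gaussian finite_index])

lemma X_mean: "j \<in> I \<Longrightarrow> expectation (X j) = 0"
  using gaussian by (simp add: zero_mean_gaussian_vector_def)

lemma X_square_integrable: "j \<in> I \<Longrightarrow> integrable M (\<lambda>\<omega>. (X j \<omega>)\<^sup>2)"
  by (rule centered_gaussian_rv(1)[OF X_gaussian X_mean])

lemma residual_measurable: "j \<in> I \<Longrightarrow> k \<in> I \<Longrightarrow> residual j k \<in> borel_measurable M"
  unfolding residual_def using X_measurable[of j] X_measurable[of k] by measurable

lemma X_distributed: "j \<in> I \<Longrightarrow> var j > 0 \<Longrightarrow> distributed M lborel (X j) (dens j)"
  unfolding var_def by (rule centered_gaussian_rv(3)[OF X_gaussian X_mean])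

text \<open>The product is the squared correlation of \<open>X j\<close> and \<open>X k\<close>.\<close>
lemma reg_mult_le_1:
  assumes j: "j \<in> I" "var j > 0" and k: "k \<in> I" "var k > 0"
  shows "reg j k * reg k j \<le> 1"
proof -
  define e where "e = expectation (\<lambda>\<omega>. X k \<omega> * X j \<omega>)"
  have rj: "reg j k = e / var j" and rk: "reg k j = e / var k"
    by (simp_all add: reg_def e_def mult.commute)
  have int: "integrable M (\<lambda>\<omega>. X k \<omega> * X j \<omega>)"
    by (intro integrable_mult_if_square_integrable X_measurable X_square_integrable j k)
  have sq: "(X k \<omega> - reg j k * X j \<omega>)\<^sup>2
      = (X k \<omega>)\<^sup>2 - 2 * reg j k * (X k \<omega> * X j \<omega>) + (reg j k)\<^sup>2 * (X j \<omega>)\<^sup>2" for \<omega>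
    by (simp add: power2_eq_square algebra_simps)
  have "0 \<le> expectation (\<lambda>\<omega>. (X k \<omega> - reg j k * X j \<omega>)\<^sup>2)" by simp
  also have "\<dots> = var k - 2 * reg j k * e + (reg j k)\<^sup>2 * var j"
    unfolding sq using int X_square_integrable[OF j(1)] X_square_integrable[OF k(1)]
    by (simp add: var_def e_def)
  also have "\<dots> = var k - e * e / var j"
    using j(2) by (simp add: rj power2_eq_square field_simps)
  finally have "e * e / var j \<le> var k" by simp
  then have "e * e \<le> var j * var k" using j(2) by (simp add: field_simps)
  then have "e * e / (var j * var k) \<le> 1" using j k by simp
  then show ?thesis by (simp add: rj rk)
qed

text \<open>Conditioning on \<open>X j = x\<close>: by independence the residuals keep their law.\<close>
lemma emeasure_regression:
  assumes j: "j \<in> I" "var j > 0"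
    and C: "C \<in> sets (borel \<Otimes>\<^sub>M PiM I (\<lambda>_. borel))"
  shows "emeasure M {\<omega> \<in> space M. (X j \<omega>, \<lambda>k\<in>I. residual j k \<omega>) \<in> C}
    = (\<integral>\<^sup>+x. ennreal (dens j x) * emeasure M {\<omega> \<in> space M. (x, \<lambda>k\<in>I. residual j k \<omega>) \<in> C} \<partial>lborel)"
proof -
  define R where "R = (\<lambda>\<omega>. \<lambda>k\<in>I. residual j k \<omega>)"
  let ?P = "PiM I (\<lambda>_. borel :: real measure)"
  have [measurable]: "R \<in> measurable M ?P"
    unfolding R_def by (rule measurable_restrict) (rule residual_measurable[OF j(1)])
  have [measurable]: "X j \<in> borel_measurable M" by (rule X_measurable[OF j(1)])
  have eq: "distr M borel (X j) \<Otimes>\<^sub>M distr M ?P R = distr M (borel \<Otimes>\<^sub>M ?P) (\<lambda>\<omega>. (X j \<omega>, R \<omega>))"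
    using gaussian_regression_residuals_indep[OF gaussian finite_index j(1)] j(2)
    by (simp add: R_def residual_def reg_def var_def)
  interpret R: prob_space "distr M ?P R" by (rule prob_space_distr) simp
  have dX: "distr M borel (X j) = density lborel (\<lambda>x. ennreal (dens j x))"
    using distributed_distr_eq_density[OF X_distributed[OF j]] by (simp cong: distr_cong)
  have C': "C \<in> sets (distr M borel (X j) \<Otimes>\<^sub>M distr M ?P R)"
    using C by (simp cong: sets_pair_measure_cong)
  have "emeasure M {\<omega> \<in> space M. (X j \<omega>, R \<omega>) \<in> C} = emeasure (distr M (borel \<Otimes>\<^sub>M ?P) (\<lambda>\<omega>. (X j \<omega>, R \<omega>))) C"
    using C by (subst emeasure_distr) (auto intro!: arg_cong[where f = "emeasure M"])
  also have "\<dots> = emeasure (distr M borel (X j) \<Otimes>\<^sub>M distr M ?P R) C" by (simp add: eq)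
  also have "\<dots> = (\<integral>\<^sup>+x. emeasure (distr M ?P R) (Pair x -` C) \<partial>distr M borel (X j))"
    by (rule R.emeasure_pair_measure_alt[OF C'])
  also have "\<dots> = (\<integral>\<^sup>+x. ennreal (dens j x) * emeasure (distr M ?P R) (Pair x -` C) \<partial>lborel)"
    unfolding dX
  proof (rule nn_integral_density)
    show "(\<lambda>x. emeasure (distr M ?P R) (Pair x -` C)) \<in> borel_measurable lborel"
      using R.measurable_emeasure_Pair[of C borel] C by (simp cong: sets_pair_measure_cong)
  qed simp
  also have "\<dots> = (\<integral>\<^sup>+x. ennreal (dens j x) * emeasure M {\<omega> \<in> space M. (x, R \<omega>) \<in> C} \<partial>lborel)"
  proof (intro nn_integral_cong arg_cong2[where f = "(*)"] refl)
    fix x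
    have "Pair x -` C \<in> sets ?P" using sets_Pair1[OF C] .
    then show "emeasure (distr M ?P R) (Pair x -` C) = emeasure M {\<omega> \<in> space M. (x, R \<omega>) \<in> C}"
      by (subst emeasure_distr) (auto intro!: arg_cong[where f = "emeasure M"])
  qed
  finally show ?thesis by (simp add: R_def)
qed

lemma tie_le_section_measurable:
  assumes [measurable]: "A \<in> sets borel" and f[measurable]: "f \<in> borel_measurable borel"
  shows "{p \<in> space (borel \<Otimes>\<^sub>M PiM I (\<lambda>_. borel)). fst p \<in> A \<and>
    (\<forall>k\<in>I. tie_le k j (snd p k) ((1 - reg j k) * f (fst p)))} \<in> sets (borel \<Otimes>\<^sub>M PiM I (\<lambda>_. borel :: real measure))"
proof -
  have "Measurable.pred (borel \<Otimes>\<^sub>M PiM I (\<lambda>_. borel)) (\<lambda>p. tie_le k j (snd p k) ((1 - reg j k) * f (fst p)))"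
    if [measurable]: "k \<in> I" for k
    unfolding tie_le_def by measurable
  then have "Measurable.pred (borel \<Otimes>\<^sub>M PiM I (\<lambda>_. borel)) (\<lambda>p. fst p \<in> A \<and> (\<forall>k\<in>I. tie_le k j (snd p k) ((1 - reg j k) * f (fst p))))"
    using finite_index by (intro pred_intros_logic pred_intros_finite) measurable
  then show ?thesis by (simp add: pred_def)
qed

lemma facet_sets: "j \<in> I \<Longrightarrow> facet j x \<in> events"
proof -
  assume j: "j \<in> I"
  have "Measurable.pred M (\<lambda>\<omega>. \<forall>k\<in>I. tie_le k j (residual j k \<omega>) ((1 - reg j k) * x))"
  proof (intro pred_intros_finite finite_index)
    fix k assume "k \<in> I"
    note [measurable] = residual_measurable[OF j this]
    show "Measurable.pred M (\<lambda>\<omega>. tie_le k j (residual j k \<omega>) ((1 - reg j k) * x))"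
      unfolding tie_le_def by measurable
  qed
  then show ?thesis by (simp add: pred_def facet_def)
qed

text \<open>So \<open>dens j x * prob (facet j x)\<close> is the contribution of index \<open>j\<close> to the density of the maximum.\<close>
lemma emeasure_first_argmax:
  assumes j: "j \<in> I" "var j > 0" and A: "A \<in> sets borel"
  shows "emeasure M {\<omega> \<in> space M. X j \<omega> \<in> A \<and> (\<forall>k\<in>I. tie_le k j (X k \<omega>) (X j \<omega>))}
    = (\<integral>\<^sup>+x. ennreal (dens j x * prob (facet j x)) * indicator A x \<partial>lborel)"
proof -
  let ?C = "{p \<in> space (borel \<Otimes>\<^sub>M PiM I (\<lambda>_. borel)). fst p \<in> A \<and>
    (\<forall>k\<in>I. tie_le k j (snd p k) ((1 - reg j k) * fst p))}"
  have iff: "tie_le k j (residual j k \<omega>) ((1 - reg j k) * X j \<omega>) \<longleftrightarrow> tie_le k j (X k \<omega>) (X j \<omega>)" for k \<omega>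
    using tie_le_diff_iff[of k j "X k \<omega>" "reg j k * X j \<omega>" "X j \<omega>"]
    by (simp add: residual_def left_diff_distrib)
  have C: "(x, \<lambda>k\<in>I. residual j k \<omega>) \<in> ?C \<longleftrightarrow> x \<in> A \<and> (\<forall>k\<in>I. tie_le k j (residual j k \<omega>) ((1 - reg j k) * x))" for x \<omega>
    by (auto simp: space_pair_measure space_PiM)
  have "{\<omega> \<in> space M. x \<in> A \<and> (\<forall>k\<in>I. tie_le k j (residual j k \<omega>) ((1 - reg j k) * x))} = (if x \<in> A then facet j x else {})" for x
    by (auto simp: facet_def)
  then show ?thesis
    using emeasure_regression[OF j tie_le_section_measurable[OF A, where f = "\<lambda>x. x" and j = j]]
    unfolding C iff
    by (auto simp: emeasure_eq_measure ennreal_mult indicator_def intro!: nn_integral_cong)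
qed

lemma prob_shadow:
  assumes j: "j \<in> I" "var j > 0"
  shows "prob ({\<omega> \<in> space M. X j \<omega> > x} \<inter> facet j x) = prob {\<omega> \<in> space M. X j \<omega> > x} * prob (facet j x)"
proof -
  let ?C = "{p \<in> space (borel \<Otimes>\<^sub>M PiM I (\<lambda>_. borel)). fst p \<in> {x<..} \<and>
    (\<forall>k\<in>I. tie_le k j (snd p k) ((1 - reg j k) * x))}"
  have C: "(y, \<lambda>k\<in>I. residual j k \<omega>) \<in> ?C \<longleftrightarrow> y > x \<and> (\<forall>k\<in>I. tie_le k j (residual j k \<omega>) ((1 - reg j k) * x))" for y \<omega>
    by (auto simp: space_pair_measure space_PiM)
  have 1: "{\<omega> \<in> space M. y > x \<and> (\<forall>k\<in>I. tie_le k j (residual j k \<omega>) ((1 - reg j k) * x))} = (if y > x then facet j x else {})" for y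
    by (auto simp: facet_def)
  have 2: "{\<omega> \<in> space M. X j \<omega> > x} \<inter> facet j x = {\<omega> \<in> space M. X j \<omega> > x \<and> (\<forall>k\<in>I. tie_le k j (residual j k \<omega>) ((1 - reg j k) * x))}"
    by (auto simp: facet_def)
  have "emeasure M ({\<omega> \<in> space M. X j \<omega> > x} \<inter> facet j x)
      = (\<integral>\<^sup>+y. ennreal (dens j y) * emeasure M (if y > x then facet j x else {}) \<partial>lborel)"
    using emeasure_regression[OF j tie_le_section_measurable[where A = "{x<..}" and f = "\<lambda>_. x" and j = j]]
    unfolding C 1 2 by simp
  also have "\<dots> = (\<integral>\<^sup>+y. ennreal (dens j y) * indicator {x<..} y * ennreal (prob (facet j x)) \<partial>lborel)"
    by (intro nn_integral_cong) (auto simp: emeasure_eq_measure)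
  also have "\<dots> = (\<integral>\<^sup>+y. ennreal (dens j y) * indicator {x<..} y \<partial>lborel) * ennreal (prob (facet j x))"
    by (rule nn_integral_multc) simp
  also have "(\<integral>\<^sup>+y. ennreal (dens j y) * indicator {x<..} y \<partial>lborel) = emeasure M (X j -` {x<..} \<inter> space M)"
    by (rule distributed_emeasure[OF X_distributed[OF j], symmetric]) simp
  also have "X j -` {x<..} \<inter> space M = {\<omega> \<in> space M. X j \<omega> > x}" by auto
  finally show ?thesis
    by (simp add: emeasure_eq_measure ennreal_mult[symmetric])
qed

text \<open>The event \<open>X j > x\<close> intersected with \<open>facet j x\<close> is the shadow of the facet \<open>j\<close>: the points reached
from the facet by moving outwards in the direction normal to it for the covariance. Distinct facets of
a convex set have disjoint shadows; here this is \<open>tie_le_shadow_disjoint\<close> applied to the excesses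
over \<open>x\<close>.\<close>
lemma sum_shadow_le_1:
  "(\<Sum>j | j \<in> I \<and> var j > 0. prob {\<omega> \<in> space M. X j \<omega> > x} * prob (facet j x)) \<le> 1"
proof -
  define J where "J = {j. j \<in> I \<and> var j > 0}"
  define S where "S j = {\<omega> \<in> space M. X j \<omega> > x} \<inter> facet j x" for j
  have J: "finite J" "J \<subseteq> I" using finite_index by (auto simp: J_def)
  have S: "S j \<in> events" if "j \<in> J" for j
  proof -
    have "j \<in> I" using that J by auto
    note [measurable] = X_measurable[OF this] facet_sets[OF this]
    show ?thesis unfolding S_def by measurable
  qed
  have "disjoint_family_on S J"
  proof (unfold disjoint_family_on_def, intro ballI impI)
    fix j k assume jk: "j \<in> J" "k \<in> J" "j \<noteq> k"
    show "S j \<inter> S k = {}"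
    proof (rule equals0I)
      fix \<omega> assume \<omega>: "\<omega> \<in> S j \<inter> S k"
      have "tie_le k j (residual j k \<omega>) ((1 - reg j k) * x)" "tie_le j k (residual k j \<omega>) ((1 - reg k j) * x)"
        using \<omega> jk J by (auto simp: S_def facet_def)
      then have "tie_le k j (X k \<omega> - x) (reg j k * (X j \<omega> - x))" "tie_le j k (X j \<omega> - x) (reg k j * (X k \<omega> - x))"
        using jk(3) by (simp_all add: residual_def tie_le_def algebra_simps split: if_splits)
      moreover have "X j \<omega> - x > 0" "X k \<omega> - x > 0" using \<omega> by (auto simp: S_def)
      moreover have "reg j k * reg k j \<le> 1" using reg_mult_le_1 jk by (auto simp: J_def)
      ultimately show False using tie_le_shadow_disjoint jk(3) by blast
    qed
  qed
  then have "(\<Sum>j\<in>J. prob (S j)) = prob (\<Union>j\<in>J. S j)"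
    using S by (intro finite_measure_finite_Union[symmetric] J) auto
  also have "\<dots> \<le> 1" by simp
  finally show ?thesis
    unfolding J_def[symmetric] S_def
    by (subst (asm) sum.cong[OF refl prob_shadow]) (auto simp: J_def)
qed

end

section \<open>Anti-concentration of the maximum\<close>

context zero_mean_gaussian_family
begin

lemma x_dens_le_mills:
  assumes j: "j \<in> I" "var j > 0" and x: "x > 0"
  shows "x * dens j x \<le> (x\<^sup>2 / var j + 1) * prob {\<omega> \<in> space M. X j \<omega> > x}"
proof -
  have "ennreal (x * dens j x)
      \<le> ennreal (x\<^sup>2 / var j + 1) * (\<integral>\<^sup>+y. ennreal (dens j y) * indicator {x<..} y \<partial>lborel)"
    using mills_ratio_normal_density[OF x, of "sqrt (var j)"] j by simp
  also have "(\<integral>\<^sup>+y. ennreal (dens j y) * indicator {x<..} y \<partial>lborel) = emeasure M (X j -` {x<..} \<inter> space M)"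
    by (rule distributed_emeasure[OF X_distributed[OF j], symmetric]) simp
  also have "X j -` {x<..} \<inter> space M = {\<omega> \<in> space M. X j \<omega> > x}" by auto
  also have "ennreal (x\<^sup>2 / var j + 1) * emeasure M {\<omega> \<in> space M. X j \<omega> > x}
      = ennreal ((x\<^sup>2 / var j + 1) * prob {\<omega> \<in> space M. X j \<omega> > x})"
    unfolding emeasure_eq_measure using j by (intro ennreal_mult[symmetric]) auto
  finally show ?thesis
    using j by (subst (asm) ennreal_le_iff) auto
qed

text \<open>Up to the level \<open>x\<^sup>2 / var j = 2 * ln (card I)\<close>, Mills' ratio charges the density to the tail probability.
Beyond that level the density is so small that it can be summed over all indices.\<close>
lemma x_dens_le:
  assumes j: "j \<in> I" "var j > 0" and x: "x > 0" and d: "card I \<ge> 2"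
  shows "x * dens j x \<le> (2 * ln (card I) + 1) * prob {\<omega> \<in> space M. X j \<omega> > x}
    + sqrt (ln (card I) / pi) / card I"
proof -
  have "ln 2 \<le> ln (real (card I))" using d by simp
  then have L: "2 * ln (real (card I)) \<ge> 1" using ln2_ge_two_thirds by linarith
  show ?thesis
  proof (cases "x\<^sup>2 / var j \<le> 2 * ln (card I)")
    case True
    then have "(x\<^sup>2 / var j + 1) * prob {\<omega> \<in> space M. X j \<omega> > x} \<le> (2 * ln (card I) + 1) * prob {\<omega> \<in> space M. X j \<omega> > x}"
      by (intro mult_right_mono) auto
    moreover have "sqrt (ln (card I) / pi) / card I \<ge> 0" using L by simp
    ultimately show ?thesis using x_dens_le_mills[OF j x] by linarith
  next
    case False
    then have "x * dens j x \<le> sqrt (2 * ln (card I) / (2 * pi)) * exp (- (2 * ln (card I)) / 2)"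
      using x j L by (intro normal_density_far_tail_le) auto
    also have "\<dots> = sqrt (ln (card I) / pi) / card I"
    proof -
      have "exp (- (2 * ln (real (card I))) / 2) = 1 / card I"
        using d by (simp add: exp_minus inverse_eq_divide)
      then show ?thesis by simp
    qed
    finally show ?thesis using L by (simp add: add_increasing)
  qed
qed

lemma max_density_le:
  assumes x: "x > 0" and d: "card I \<ge> 2"
  shows "(\<Sum>j | j \<in> I \<and> var j > 0. dens j x * prob (facet j x))
    \<le> (2 * ln (card I) + 1 + sqrt (ln (card I) / pi)) / x"
proof -
  define J where "J = {j. j \<in> I \<and> var j > 0}"
  define K where "K = sqrt (ln (card I) / pi)"
  have lnd: "ln (real (card I)) \<ge> 0" using d by simp
  then have K: "K \<ge> 0" by (simp add: K_def)
  have J: "finite J" "card J \<le> card I" using finite_index by (auto simp: J_def intro: card_mono)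
  have "x * (\<Sum>j\<in>J. dens j x * prob (facet j x)) = (\<Sum>j\<in>J. (x * dens j x) * prob (facet j x))"
    by (simp add: sum_distrib_left mult.assoc)
  also have "\<dots> \<le> (\<Sum>j\<in>J. (2 * ln (card I) + 1) * (prob {\<omega> \<in> space M. X j \<omega> > x} * prob (facet j x)) + K / card I)"
  proof (rule sum_mono)
    fix j assume "j \<in> J"
    then have j: "j \<in> I" "var j > 0" by (auto simp: J_def)
    have "(x * dens j x) * prob (facet j x)
        \<le> ((2 * ln (card I) + 1) * prob {\<omega> \<in> space M. X j \<omega> > x} + K / card I) * prob (facet j x)"
      using x_dens_le[OF j x d] by (intro mult_right_mono) (auto simp: K_def)
    also have "\<dots> = (2 * ln (card I) + 1) * (prob {\<omega> \<in> space M. X j \<omega> > x} * prob (facet j x)) + K / card I * prob (facet j x)"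
      by (simp add: distrib_right)
    also have "K / card I * prob (facet j x) \<le> K / card I"
      using K by (intro mult_left_le) auto
    finally show "(x * dens j x) * prob (facet j x)
        \<le> (2 * ln (card I) + 1) * (prob {\<omega> \<in> space M. X j \<omega> > x} * prob (facet j x)) + K / card I"
      by simp
  qed
  also have "\<dots> = (2 * ln (card I) + 1) * (\<Sum>j\<in>J. prob {\<omega> \<in> space M. X j \<omega> > x} * prob (facet j x)) + card J * (K / card I)"
    by (simp add: sum.distrib sum_distrib_left)
  also have "\<dots> \<le> (2 * ln (card I) + 1) * 1 + card I * (K / card I)"
    using sum_shadow_le_1[of x] J lnd K unfolding J_def[symmetric]
    by (intro add_mono mult_left_mono mult_right_mono) auto
  also have "\<dots> = 2 * ln (card I) + 1 + K" using d by simp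
  finally have "(\<Sum>j\<in>J. dens j x * prob (facet j x)) * x \<le> 2 * ln (card I) + 1 + K"
    by (subst mult.commute)
  then show ?thesis
    unfolding J_def[symmetric] K_def[symmetric] by (rule mult_imp_le_div_pos[OF x])
qed

lemma prob_facet_measurable: "j \<in> I \<Longrightarrow> (\<lambda>x. prob (facet j x)) \<in> borel_measurable borel"
proof -
  assume j: "j \<in> I"
  let ?Q = "{p \<in> space (borel \<Otimes>\<^sub>M M). \<forall>k\<in>I. tie_le k j (residual j k (snd p)) ((1 - reg j k) * fst p)}"
  have "Measurable.pred (borel \<Otimes>\<^sub>M M) (\<lambda>p. \<forall>k\<in>I. tie_le k j (residual j k (snd p)) ((1 - reg j k) * fst p))"
  proof (rule pred_intros_finite(3)[OF finite_index])
    fix k assume "k \<in> I"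
    have [measurable]: "(\<lambda>p. residual j k (snd p)) \<in> borel_measurable (borel \<Otimes>\<^sub>M M)"
      by (rule measurable_compose[OF measurable_snd residual_measurable[OF j \<open>k \<in> I\<close>]])
    show "Measurable.pred (borel \<Otimes>\<^sub>M M) (\<lambda>p. tie_le k j (residual j k (snd p)) ((1 - reg j k) * fst p))"
      unfolding tie_le_def by measurable
  qed
  then have Q: "?Q \<in> sets (borel \<Otimes>\<^sub>M M)" by (simp add: pred_def)
  from measurable_emeasure_Pair[OF Q] have "(\<lambda>x. enn2real (emeasure M (Pair x -` ?Q))) \<in> borel_measurable borel"
    by (rule borel_measurable_enn2real)
  moreover have "Pair x -` ?Q = facet j x" for x
    by (auto simp: facet_def space_pair_measure)
  ultimately show ?thesis by (simp add: measure_def)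
qed

text \<open>A bound without any variance on the right side: the density of the maximum at \<open>x\<close> is at most a
constant divided by \<open>x\<close>. This is how coordinates with small or zero variance cause no harm at
a positive level.\<close>
theorem prob_max_in_interval_le:
  assumes d: "card I \<ge> 2" and a: "0 < a" "a \<le> b"
  shows "prob {\<omega> \<in> space M. Max ((\<lambda>j. X j \<omega>) ` I) \<in> {a..b}}
    \<le> (2 * ln (card I) + 1 + sqrt (ln (card I) / pi)) * ln (b / a)"
proof -
  define J where "J = {j. j \<in> I \<and> var j > 0}"
  define C where "C = 2 * ln (card I) + 1 + sqrt (ln (card I) / pi)"
  define E where "E j = {\<omega> \<in> space M. X j \<omega> \<in> {a..b} \<and> (\<forall>k\<in>I. tie_le k j (X k \<omega>) (X j \<omega>))}" for j
  have I: "I \<noteq> {}" using d by auto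
  have J: "finite J" "J \<subseteq> I" using finite_index by (auto simp: J_def)
  have C: "C \<ge> 0" using d by (simp add: C_def)
  have E_sets: "E j \<in> events" if j: "j \<in> I" for j
  proof -
    note [measurable] = X_measurable[OF j]
    have [measurable]: "Measurable.pred M (\<lambda>\<omega>. \<forall>k\<in>I. tie_le k j (X k \<omega>) (X j \<omega>))"
    proof (rule pred_intros_finite(3)[OF finite_index])
      fix k assume "k \<in> I"
      note [measurable] = X_measurable[OF this]
      show "Measurable.pred M (\<lambda>\<omega>. tie_le k j (X k \<omega>) (X j \<omega>))"
        unfolding tie_le_def by measurable
    qed
    show ?thesis unfolding E_def by measurable
  qed
  \<comment> \<open>A coordinate with variance zero vanishes almost surely and cannot reach \<open>a > 0\<close>.\<close>
  have E_null: "emeasure M (E j) = 0" if j: "j \<in> I" "j \<notin> J" for j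
  proof -
    have [measurable]: "X j \<in> borel_measurable M" by (rule X_measurable[OF j(1)])
    have "var j \<ge> 0" by (simp add: var_def)
    then have "var j = 0" using j by (auto simp: J_def)
    then have "AE \<omega> in M. (X j \<omega>)\<^sup>2 = 0"
      using integral_nonneg_eq_0_iff_AE[OF X_square_integrable[OF j(1)]] by (simp add: var_def)
    then have "AE \<omega> in M. \<omega> \<notin> E j"
      by eventually_elim (use a in \<open>simp add: E_def\<close>)
    moreover have "{\<omega> \<in> space M. \<not> \<omega> \<notin> E j} = E j" by (auto simp: E_def)
    ultimately show ?thesis by (simp only: AE_iff_measurable[OF E_sets[OF j(1)]])
  qed
  have "{\<omega> \<in> space M. Max ((\<lambda>j. X j \<omega>) ` I) \<in> {a..b}} \<subseteq> (\<Union>j\<in>I. E j)"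
  proof
    fix \<omega> assume \<omega>: "\<omega> \<in> {\<omega> \<in> space M. Max ((\<lambda>j. X j \<omega>) ` I) \<in> {a..b}}"
    define m where "m = Max ((\<lambda>j. X j \<omega>) ` I)"
    define A where "A = {j\<in>I. X j \<omega> = m}"
    have "m \<in> (\<lambda>j. X j \<omega>) ` I" unfolding m_def using finite_index I by (intro Max_in) auto
    then have A: "A \<noteq> {}" "finite A" using finite_index by (auto simp: A_def)
    define j where "j = Min A"
    have "j \<in> A" unfolding j_def using A by (intro Min_in)
    then have j: "j \<in> I" "X j \<omega> = m" by (auto simp: A_def)
    have le: "X k \<omega> \<le> m" if "k \<in> I" for k unfolding m_def using finite_index that by (intro Max_ge) auto
    have "X k \<omega> < m" if "k \<in> I" "k < j" for k
    proof -
      have "k \<notin> A" using that A by (auto simp: j_def)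
      then show ?thesis using le[OF that(1)] that by (auto simp: A_def)
    qed
    then have "\<omega> \<in> E j" using \<omega> j le by (auto simp: E_def tie_le_def m_def[symmetric])
    then show "\<omega> \<in> (\<Union>j\<in>I. E j)" using j by blast
  qed
  then have "emeasure M {\<omega> \<in> space M. Max ((\<lambda>j. X j \<omega>) ` I) \<in> {a..b}} \<le> emeasure M (\<Union>j\<in>I. E j)"
    using E_sets finite_index by (intro emeasure_mono) auto
  also have "\<dots> \<le> (\<Sum>j\<in>I. emeasure M (E j))"
    using E_sets finite_index by (intro emeasure_subadditive_finite) auto
  also have "\<dots> = (\<Sum>j\<in>J. emeasure M (E j))"
    using J finite_index E_null by (intro sum.mono_neutral_right) auto
  also have "\<dots> = (\<Sum>j\<in>J. \<integral>\<^sup>+x. ennreal (dens j x * prob (facet j x)) * indicator {a..b} x \<partial>lborel)"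
    unfolding E_def by (intro sum.cong refl emeasure_first_argmax) (auto simp: J_def)
  also have "\<dots> = (\<integral>\<^sup>+x. (\<Sum>j\<in>J. ennreal (dens j x * prob (facet j x)) * indicator {a..b} x) \<partial>lborel)"
  proof (rule nn_integral_sum[symmetric])
    fix j assume "j \<in> J"
    then have "j \<in> I" using J by auto
    note [measurable] = prob_facet_measurable[OF this]
    show "(\<lambda>x. ennreal (dens j x * prob (facet j x)) * indicator {a..b} x) \<in> borel_measurable lborel"
      by measurable
  qed
  also have "\<dots> \<le> (\<integral>\<^sup>+x. ennreal (C / x) * indicator {a..b} x \<partial>lborel)"
  proof (rule nn_integral_mono)
    fix x
    show "(\<Sum>j\<in>J. ennreal (dens j x * prob (facet j x)) * indicator {a..b} x) \<le> ennreal (C / x) * indicator {a..b} x"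
    proof (cases "x \<in> {a..b}")
      case True
      then have "(\<Sum>j\<in>J. dens j x * prob (facet j x)) \<le> C / x"
        using max_density_le[of x] a d by (simp add: J_def C_def)
      then show ?thesis using True by (simp add: sum_ennreal ennreal_leI)
    qed simp
  qed
  also have "\<dots> = ennreal (C * ln b - C * ln a)"
    using a C by (intro nn_integral_FTC_Icc) (auto intro!: derivative_eq_intros)
  also have "C * ln b - C * ln a = C * ln (b / a)" using a by (simp add: ln_div right_diff_distrib)
  finally have "ennreal (prob {\<omega> \<in> space M. Max ((\<lambda>j. X j \<omega>) ` I) \<in> {a..b}}) \<le> ennreal (C * ln (b / a))"
    by (simp only: emeasure_eq_measure)
  moreover have "0 \<le> C * ln (b / a)"
    using a by (intro mult_nonneg_nonneg C ln_ge_zero) simp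
  ultimately show ?thesis
    unfolding C_def[symmetric] by (simp only: ennreal_le_iff)
qed

end

lemma ln_le_half_diff_inverse:
  assumes "y \<ge> (1::real)"
  shows "ln y \<le> (y - 1 / y) / 2"
proof -
  define g where "g z = (z - 1 / z) / 2 - ln z" for z :: real
  have "g 1 \<le> g y"
  proof (rule DERIV_nonneg_imp_nondecreasing[OF assms])
    fix z :: real assume z: "1 \<le> z" "z \<le> y"
    have "(g has_real_derivative (1 - 1 / z)\<^sup>2 / 2) (at z)"
      unfolding g_def using z
      by (auto intro!: derivative_eq_intros simp: power2_eq_square field_simps)
    then show "\<exists>D. (g has_real_derivative D) (at z) \<and> 0 \<le> D" by (intro exI conjI) auto
  qed
  then show ?thesis by (simp add: g_def)
qed

text \<open>The logarithm is at most \<open>(2 * e / t) / (1 - (e / t)\<^sup>2)\<close>, and \<open>e / t < 1 / 8\<close> makes the denominator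
at least \<open>63 / 64\<close>.\<close>
lemma ln_symmetric_interval_le:
  fixes e t :: real
  assumes e: "0 < e" "e < t / 8"
  shows "ln ((t + e) / (t - e)) \<le> 64 / 63 * (2 * e / t)"
proof -
  have t: "t > 0" "t - e > 0" using e by auto
  have "ln ((t + e) / (t - e)) \<le> ((t + e) / (t - e) - 1 / ((t + e) / (t - e))) / 2"
    using e t by (intro ln_le_half_diff_inverse) auto
  also have "\<dots> = 2 * e * t / (t\<^sup>2 - e\<^sup>2)"
  proof -
    have "t + e > 0" "t\<^sup>2 - e\<^sup>2 = (t + e) * (t - e)" using e t by (auto simp: power2_eq_square algebra_simps)
    then show ?thesis using t by (simp add: divide_simps) (simp add: power2_eq_square algebra_simps)
  qed
  also have "\<dots> \<le> 2 * e * t / (63 / 64 * t\<^sup>2)"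
  proof (rule divide_left_mono)
    have "e\<^sup>2 \<le> (t / 8)\<^sup>2" using e by (intro power_mono) auto
    then show 1: "63 / 64 * t\<^sup>2 \<le> t\<^sup>2 - e\<^sup>2" by (simp add: power_divide)
    have 2: "0 < 63 / 64 * t\<^sup>2" using t by simp
    with 1 have "0 < t\<^sup>2 - e\<^sup>2" by linarith
    then show "0 < (t\<^sup>2 - e\<^sup>2) * (63 / 64 * t\<^sup>2)" using 2 by (rule mult_pos_pos)
  qed (use e t in auto)
  also have "\<dots> = 64 / 63 * (2 * e / t)" using t by (simp add: power2_eq_square)
  finally show ?thesis .
qed

text \<open>Continuity of the distribution function ensures that the level \<open>0.95\<close> is attained, so that the
quantile is a genuine preimage.\<close>
lemma std_normal_quantile_95_gt: "std_normal_quantile 0.95 > 1437 / 1000"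
proof -
  interpret N: real_distribution std_normal_distribution by (rule real_dist_normal_dist)
  have cont: "isCont std_normal_cdf x" for x
  proof -
    have "emeasure std_normal_distribution {x} = (\<integral>\<^sup>+y. 0 \<partial>lborel)"
      using AE_lborel_singleton[of x]
      by (subst emeasure_density) (auto intro!: nn_integral_cong_AE)
    then show ?thesis by (simp add: std_normal_cdf_def N.isCont_cdf measure_def)
  qed
  have "\<forall>\<^sub>F x in at_top. std_normal_cdf x > 0.95"
    using N.cdf_lim_at_top_prob unfolding std_normal_cdf_def by (rule order_tendstoD) simp
  then obtain b where b: "\<And>x. x \<ge> b \<Longrightarrow> std_normal_cdf x > 0.95" unfolding eventually_at_top_linorder by blast
  have "\<forall>\<^sub>F x in at_bot. std_normal_cdf x < 0.95"
    using N.cdf_lim_at_bot unfolding std_normal_cdf_def by (rule order_tendstoD) simp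
  then obtain a where a: "\<And>x. x \<le> a \<Longrightarrow> std_normal_cdf x < 0.95" unfolding eventually_at_bot_linorder by blast
  have "\<exists>x. min a b \<le> x \<and> x \<le> b \<and> std_normal_cdf x = 0.95"
    using a[of "min a b"] b[of b] cont by (intro IVT) auto
  then have "0.95 \<in> range std_normal_cdf" by (metis rangeI)
  then have q: "std_normal_cdf (std_normal_quantile 0.95) = 0.95"
    unfolding std_normal_quantile_def by (rule f_inv_into_f)
  define r where "r = (1437 / 1000 :: real)"
  have r: "r > 0" by (simp add: r_def)
  have "ennreal (r * std_normal_density r)
      \<le> ennreal (r\<^sup>2 + 1) * (\<integral>\<^sup>+y. ennreal (std_normal_density y) * indicator {r<..} y \<partial>lborel)"
    using mills_ratio_normal_density[OF r, of 1] by simp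
  also have "(\<integral>\<^sup>+y. ennreal (std_normal_density y) * indicator {r<..} y \<partial>lborel) = emeasure std_normal_distribution {r<..}"
    by (subst emeasure_density) auto
  also have "ennreal (r\<^sup>2 + 1) * emeasure std_normal_distribution {r<..} = ennreal ((r\<^sup>2 + 1) * N.prob {r<..})"
    unfolding N.emeasure_eq_measure by (intro ennreal_mult[symmetric]) auto
  finally have "r * std_normal_density r \<le> (r\<^sup>2 + 1) * N.prob {r<..}"
    by (subst (asm) ennreal_le_iff) auto
  moreover have "N.prob {r<..} = 1 - std_normal_cdf r"
  proof -
    have "{r<..} = space std_normal_distribution - {..r}" by auto
    then show ?thesis
      using N.prob_compl[of "{..r}"] by (simp add: std_normal_cdf_def cdf_def)
  qed
  moreover have "(5/100) * (r\<^sup>2 + 1) < r * std_normal_density r"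
    unfolding r_def by (rule std_normal_density_quantile_bound)
  ultimately have "(r\<^sup>2 + 1) * (5/100) < (r\<^sup>2 + 1) * (1 - std_normal_cdf r)" by simp
  then have "5/100 < 1 - std_normal_cdf r"
    by (subst (asm) mult_less_cancel_left_pos) (auto simp: add_nonneg_pos)
  then have "std_normal_cdf r < std_normal_cdf (std_normal_quantile 0.95)" unfolding q by simp
  then show ?thesis
    using N.cdf_nondecreasing[of "std_normal_quantile 0.95" r] unfolding std_normal_cdf_def r_def by linarith
qed

text \<open>Since \<open>2 * 707 / 1000\<close> is slightly less than \<open>sqrt 2\<close>, the leading terms \<open>ln d\<close> compare correctly; the
summand \<open>3\<close> absorbs the rest.\<close>
lemma log_factor_le:
  assumes "d \<ge> (2::nat)"
  shows "707 / 1000 * (2 * ln d + 1 + sqrt (ln d / pi)) \<le> sqrt (ln d) * (sqrt (2 * ln (2 * d)) + 3)"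
proof -
  define s where "s = sqrt (ln (real d))"
  have "ln 2 \<le> ln (real d)" using assms by simp
  then have L: "ln (real d) \<ge> 2/3" using ln2_ge_two_thirds by linarith
  then have s2: "ln (real d) = s\<^sup>2" by (simp add: s_def)
  have s: "s \<ge> 7/10" unfolding s_def using L by (intro real_le_rsqrt) (simp add: power2_eq_square)
  have "sqrt (ln d / pi) \<le> s"
    unfolding s_def using L pi_gt3 by (simp add: real_sqrt_le_iff divide_le_eq mult_le_cancel_left1)
  then have "707 / 1000 * (2 * ln d + 1 + sqrt (ln d / pi)) \<le> 707 / 1000 * (2 * s\<^sup>2 + 1 + s)"
    unfolding s2[symmetric] by simp
  also have "\<dots> \<le> s * (1414 / 1000 * s + 3)"
    using s by (simp add: power2_eq_square algebra_simps)
  also have "\<dots> \<le> s * (sqrt (2 * ln (2 * d)) + 3)"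
  proof -
    have "ln (real d) \<le> ln (2 * d)" using assms by simp
    then have "(1414 / 1000 * s)\<^sup>2 \<le> 2 * ln (2 * d)"
      using s2 L by (simp add: power_mult_distrib power2_eq_square)
    then have "1414 / 1000 * s \<le> sqrt (2 * ln (2 * d))" by (rule real_le_rsqrt)
    then show ?thesis using s by (intro mult_left_mono) auto
  qed
  finally show ?thesis by (simp add: s_def)
qed

theorem theorem3p2:
  fixes M :: "'a measure" and d :: nat and X :: "nat \<Rightarrow> 'a \<Rightarrow> real"
    and \<sigma> t \<epsilon> :: real
  assumes "prob_space M"
    and "d \<ge> 2"
    and "zero_mean_gaussian_vector M {1..d} X"
    and "\<sigma>\<^sup>2 = Max ((\<lambda>j. \<integral>\<omega>. (X j \<omega>)\<^sup>2 \<partial>M) ` {1..d})"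
    and "\<sigma> > 0"
    and "t \<ge> \<sigma> * std_normal_quantile 0.95"
    and "\<epsilon> > 0"
    and "\<epsilon> < 1 / 8 * t"
  shows "measure M {\<omega> \<in> space M. \<bar>Max ((\<lambda>j. X j \<omega>) ` {1..d}) - t\<bar> \<le> \<epsilon>}
    \<le> 2 * \<epsilon> * (sqrt (ln (real d)) / \<sigma>) * (sqrt (2 * ln (2 * real d)) + 3)"
proof -
  interpret prob_space M by fact
  interpret zero_mean_gaussian_family M "{1..d}" X
    by unfold_locales (use assms in auto)
  define C where "C = 2 * ln (real d) + 1 + sqrt (ln (real d) / pi)"
  have C: "C \<ge> 0" using assms(2) by (simp add: C_def)
  have t: "t > 0" "\<epsilon> < t" using assms(7,8) by auto
  have "\<sigma> * (1437 / 1000) \<le> \<sigma> * std_normal_quantile 0.95"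
    using std_normal_quantile_95_gt \<open>\<sigma> > 0\<close> by (intro mult_left_mono) auto
  \<comment> \<open>\<open>64 / 63 / 1.437\<close> is just below \<open>0.707\<close>.\<close>
  then have "64 / 63 * \<sigma> \<le> 707 / 1000 * t" using assms(5,6) by linarith
  then have scale: "64 / 63 * (2 * \<epsilon> / t) \<le> 707 / 1000 * (2 * \<epsilon> / \<sigma>)"
    using t assms(5,7) by (simp add: field_simps)
  have "{\<omega> \<in> space M. \<bar>Max ((\<lambda>j. X j \<omega>) ` {1..d}) - t\<bar> \<le> \<epsilon>}
      = {\<omega> \<in> space M. Max ((\<lambda>j. X j \<omega>) ` {1..d}) \<in> {t - \<epsilon>..t + \<epsilon>}}"
    by (auto simp: abs_le_iff)
  then have "prob {\<omega> \<in> space M. \<bar>Max ((\<lambda>j. X j \<omega>) ` {1..d}) - t\<bar> \<le> \<epsilon>} \<le> C * ln ((t + \<epsilon>) / (t - \<epsilon>))"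
    using prob_max_in_interval_le[of "t - \<epsilon>" "t + \<epsilon>"] assms(2,7) t by (simp add: C_def)
  also have "\<dots> \<le> C * (707 / 1000 * (2 * \<epsilon> / \<sigma>))"
    using ln_symmetric_interval_le[of \<epsilon> t] scale assms(7,8) C by (intro mult_left_mono) auto
  also have "\<dots> = 2 * \<epsilon> / \<sigma> * (707 / 1000 * C)" by simp
  also have "\<dots> \<le> 2 * \<epsilon> / \<sigma> * (sqrt (ln d) * (sqrt (2 * ln (2 * d)) + 3))"
    using log_factor_le[OF assms(2)] assms(5,7) unfolding C_def by (intro mult_left_mono) auto
  finally show ?thesis by simp
qed

end
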